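(* There is an $O(n\log n)$-time algorithm that decides whether a given $k$-colored point set $P\subset\mathbb{R}^2$ of size $n$ contains a 4-colored cross.
   Context: A $k$-colored point set is a finite set of points in $\mathbb{R}^2$, each of which is assigned one of $k$ colors. No general position is assumed (coordinates may repeat). The open quadrants of a point $c=(c_x,c_y)$ are the four regions $\{x>c_x,y>c_y\}$, $\{x<c_x,y>c_y\}$, $\{x<c_x,y<c_y\}$, $\{x>c_x,y<c_y\}$. $P$ contains a 4-colored cross if there exists a point $c\in\mathbb{R}^2$ (not necessarily in $P$) and four points of $P$ with pairwise different colors, one in each of the four open quadrants of $c$. The model is the usual real RAM (unit-cost arithmetic and comparisons on real numbers, constant-time comparison of colors); the constant hidden in $O(n\log n)$ does not depend on $k$. *)

theory Defs
  imports Complex_Main "HOL-Library.Landau_Symbols"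
begin

section \<open>Colored point sets and 4-colored crosses\<close>

text \<open>The plane is \<^typ>\<open>real \<times> real\<close> and the colors are $0,\dots,k-1$.  The
  coloring is given by a total function, of which only the values on the point set matter.\<close>

definition k_colored_point_set ::
  "nat \<Rightarrow> (real \<times> real) set \<Rightarrow> (real \<times> real \<Rightarrow> nat) \<Rightarrow> bool" where
  "k_colored_point_set k P col \<longleftrightarrow> finite P \<and> (\<forall>p\<in>P. col p < k)"

definition NE_quadrant :: "real \<times> real \<Rightarrow> (real \<times> real) set" where
  "NE_quadrant c = {p. fst p > fst c \<and> snd p > snd c}"

definition NW_quadrant :: "real \<times> real \<Rightarrow> (real \<times> real) set" where
  "NW_quadrant c = {p. fst p < fst c \<and> snd p > snd c}"

definition SW_quadrant :: "real \<times> real \<Rightarrow> (real \<times> real) set" where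
  "SW_quadrant c = {p. fst p < fst c \<and> snd p < snd c}"

definition SE_quadrant :: "real \<times> real \<Rightarrow> (real \<times> real) set" where
  "SE_quadrant c = {p. fst p > fst c \<and> snd p < snd c}"

definition contains_four_colored_cross ::
  "(real \<times> real) set \<Rightarrow> (real \<times> real \<Rightarrow> nat) \<Rightarrow> bool" where
  "contains_four_colored_cross P col \<longleftrightarrow>
     (\<exists>c. \<exists>p\<in>P \<inter> NE_quadrant c. \<exists>q\<in>P \<inter> NW_quadrant c.
          \<exists>r\<in>P \<inter> SW_quadrant c. \<exists>s\<in>P \<inter> SE_quadrant c.
            distinct [col p, col q, col r, col s])"

section \<open>The real RAM\<close>

text \<open>
  The machine has registers and an unbounded random access memory for each of three kinds of
  data: index values (natural numbers, used for counting and addressing), real numbers, and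
  colors.  Memory is accessed by loads and stores whose address is held in an index register.
  A program is a finite list of instructions, and executing any instruction takes one time unit.

  The instruction set is deliberately restrictive, so that unit cost does not give the machine
  unrealistic power: there is no conversion from reals to index values (in particular no
  floor), index values can only be added, subtracted and compared, only integer constants
  can be written in a program, and colors can only be moved and tested for equality.
\<close>

datatype instr =
    IConst nat nat       \<comment> \<open>index register := constant\<close>
  | IMove nat nat        \<comment> \<open>throughout, the first operand is the destination\<close>
  | IAdd nat nat nat
  | ISub nat nat nat
  | ILoad nat nat        \<comment> \<open>the second operand is the index register holding the address\<close>
  | IStore nat nat       \<comment> \<open>address register first, source register second\<close>
  | RConst nat int
  | RMove nat nat
  | RAdd nat nat nat
  | RSub nat nat nat
  | RMul nat nat nat
  | RDiv nat nat nat
  | RLoad nat nat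
  | RStore nat nat
  | CMove nat nat
  | CLoad nat nat
  | CStore nat nat
  | Jump nat             \<comment> \<open>jump targets are absolute positions in the program\<close>
  | JumpILess nat nat nat
  | JumpIEq nat nat nat
  | JumpRLess nat nat nat
  | JumpREq nat nat nat
  | JumpCEq nat nat nat
  | Halt bool            \<comment> \<open>stop with answer yes or no\<close>

record ram_state =
  pc :: nat
  ireg :: "nat \<Rightarrow> nat"
  rreg :: "nat \<Rightarrow> real"
  creg :: "nat \<Rightarrow> nat"
  imem :: "nat \<Rightarrow> nat"
  rmem :: "nat \<Rightarrow> real"
  cmem :: "nat \<Rightarrow> nat"

definition next_pc :: "ram_state \<Rightarrow> ram_state" where
  "next_pc s = s\<lparr>pc := Suc (pc s)\<rparr>"

definition jump_if :: "bool \<Rightarrow> nat \<Rightarrow> ram_state \<Rightarrow> ram_state" where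
  "jump_if b l s = (if b then s\<lparr>pc := l\<rparr> else next_pc s)"

text \<open>Index subtraction is truncated at $0$; real division by $0$ yields $0$.\<close>

fun exec_instr :: "instr \<Rightarrow> ram_state \<Rightarrow> ram_state" where
  "exec_instr (IConst d n) s = next_pc (s\<lparr>ireg := (ireg s)(d := n)\<rparr>)"
| "exec_instr (IMove d a) s = next_pc (s\<lparr>ireg := (ireg s)(d := ireg s a)\<rparr>)"
| "exec_instr (IAdd d a b) s = next_pc (s\<lparr>ireg := (ireg s)(d := ireg s a + ireg s b)\<rparr>)"
| "exec_instr (ISub d a b) s = next_pc (s\<lparr>ireg := (ireg s)(d := ireg s a - ireg s b)\<rparr>)"
| "exec_instr (ILoad d a) s = next_pc (s\<lparr>ireg := (ireg s)(d := imem s (ireg s a))\<rparr>)"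
| "exec_instr (IStore a b) s = next_pc (s\<lparr>imem := (imem s)(ireg s a := ireg s b)\<rparr>)"
| "exec_instr (RConst d z) s = next_pc (s\<lparr>rreg := (rreg s)(d := real_of_int z)\<rparr>)"
| "exec_instr (RMove d a) s = next_pc (s\<lparr>rreg := (rreg s)(d := rreg s a)\<rparr>)"
| "exec_instr (RAdd d a b) s = next_pc (s\<lparr>rreg := (rreg s)(d := rreg s a + rreg s b)\<rparr>)"
| "exec_instr (RSub d a b) s = next_pc (s\<lparr>rreg := (rreg s)(d := rreg s a - rreg s b)\<rparr>)"
| "exec_instr (RMul d a b) s = next_pc (s\<lparr>rreg := (rreg s)(d := rreg s a * rreg s b)\<rparr>)"
| "exec_instr (RDiv d a b) s = next_pc (s\<lparr>rreg := (rreg s)(d := rreg s a / rreg s b)\<rparr>)"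
| "exec_instr (RLoad d a) s = next_pc (s\<lparr>rreg := (rreg s)(d := rmem s (ireg s a))\<rparr>)"
| "exec_instr (RStore a b) s = next_pc (s\<lparr>rmem := (rmem s)(ireg s a := rreg s b)\<rparr>)"
| "exec_instr (CMove d a) s = next_pc (s\<lparr>creg := (creg s)(d := creg s a)\<rparr>)"
| "exec_instr (CLoad d a) s = next_pc (s\<lparr>creg := (creg s)(d := cmem s (ireg s a))\<rparr>)"
| "exec_instr (CStore a b) s = next_pc (s\<lparr>cmem := (cmem s)(ireg s a := creg s b)\<rparr>)"
| "exec_instr (Jump l) s = s\<lparr>pc := l\<rparr>"
| "exec_instr (JumpILess a b l) s = jump_if (ireg s a < ireg s b) l s"
| "exec_instr (JumpIEq a b l) s = jump_if (ireg s a = ireg s b) l s"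
| "exec_instr (JumpRLess a b l) s = jump_if (rreg s a < rreg s b) l s"
| "exec_instr (JumpREq a b l) s = jump_if (rreg s a = rreg s b) l s"
| "exec_instr (JumpCEq a b l) s = jump_if (creg s a = creg s b) l s"
| "exec_instr (Halt ans) s = s"

text \<open>A program counter outside the program makes the machine hang without an answer.\<close>

definition step :: "instr list \<Rightarrow> ram_state \<Rightarrow> ram_state" where
  "step prog s = (if pc s < length prog then exec_instr (prog ! pc s) s else s)"

definition halted :: "instr list \<Rightarrow> ram_state \<Rightarrow> bool \<Rightarrow> bool" where
  "halted prog s ans \<longleftrightarrow> pc s < length prog \<and> prog ! pc s = Halt ans"

definition answers_within :: "instr list \<Rightarrow> ram_state \<Rightarrow> bool \<Rightarrow> nat \<Rightarrow> bool" where
  "answers_within prog s ans t \<longleftrightarrow> (\<exists>m\<le>t. halted prog ((step prog ^^ m) s) ans)"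

text \<open>The answer is unique: a halted machine does not change its state any more.\<close>

lemma halted_step_power: "halted prog s ans \<Longrightarrow> (step prog ^^ m) s = s"
  by (induction m) (auto simp: halted_def step_def)

lemma halted_later:
  assumes "halted prog ((step prog ^^ m) s) ans" and "m \<le> m'"
  shows "(step prog ^^ m') s = (step prog ^^ m) s"
proof -
  have "(step prog ^^ m') s = (step prog ^^ (m' - m)) ((step prog ^^ m) s)"
    using assms(2) by (metis comp_apply funpow_add le_add_diff_inverse2)
  then show ?thesis
    using halted_step_power[OF assms(1)] by simp
qed

lemma answers_within_unique:
  assumes "answers_within prog s a t" and "answers_within prog s b t'"
  shows "a = b"
proof -
  obtain m m' where
    m: "halted prog ((step prog ^^ m) s) a" and m': "halted prog ((step prog ^^ m') s) b"
    using assms by (auto simp: answers_within_def)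
  have "(step prog ^^ m) s = (step prog ^^ m') s"
    using halted_later[OF m, of m'] halted_later[OF m', of m] by (cases "m \<le> m'") auto
  then show ?thesis
    using m m' by (simp add: halted_def)
qed

section \<open>Input and running time\<close>

text \<open>
  The points are listed in arbitrary order.  Index register $0$ holds the number of points;
  the coordinates of point $i$ are in real memory cells $2i$ and $2i+1$, its color in color
  memory cell $i$.  Everything else is $0$.  The number $k$ of colors is not part of the input.
\<close>

definition input_state :: "(real \<times> real) list \<Rightarrow> (real \<times> real \<Rightarrow> nat) \<Rightarrow> ram_state" where
  "input_state ps col =
     \<lparr>pc = 0,
      ireg = (\<lambda>j. if j = 0 then length ps else 0),
      rreg = (\<lambda>j. 0),
      creg = (\<lambda>j. 0),
      imem = (\<lambda>j. 0),
      rmem = (\<lambda>j. if j < 2 * length ps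
                   then (if even j then fst (ps ! (j div 2)) else snd (ps ! (j div 2)))
                   else 0),
      cmem = (\<lambda>j. if j < length ps then col (ps ! j) else 0)\<rparr>"

definition decides_four_colored_cross_in_time :: "instr list \<Rightarrow> (nat \<Rightarrow> nat) \<Rightarrow> bool" where
  "decides_four_colored_cross_in_time prog T \<longleftrightarrow>
     (\<forall>k P col ps. k_colored_point_set k P col \<longrightarrow> distinct ps \<longrightarrow> set ps = P \<longrightarrow>
        answers_within prog (input_state ps col) (contains_four_colored_cross P col) (T (card P)))"

end

theory Submission
  imports Defs "HOL-Library.Multiset"
begin

text \<open>
  Sort the points by \<open>x\<close>. A cross is a vertical line between two consecutive distinct
  \<open>x\<close>-coordinates together with upper and lower points of four different colors on its left and
  right, all the upper ones above all the lower ones. On one side of the line, a candidate upper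
  point may be replaced by any higher one whose color differs from the colors of the other three
  points; so it suffices to know, for every prefix and suffix of the sorted sequence, the highest
  points of the four colors that reach highest (its champions), and likewise, with \<open>y\<close> negated,
  the lowest ones. These are maintained in constant time per point, using only equality tests on
  colors, and each line is then decided by trying all $4^4$ combinations of champions.
\<close>

section \<open>Structured programs\<close>

text \<open>Why four: a replacement has to avoid the colors of the other three points of the cross,
  and among four distinct colors at least one does. The points are exchanged one at a time, each
  against the current colors of the other three, and no exchange narrows the gap. The obstacle is
  that colors can be neither ordered nor used as addresses, so no table per color is available. A
  list of constant length, searched by comparison, takes its place, and this keeps the constant
  independent of the number of colors. A sentinel below all \<open>y\<close> and \<open>-y\<close>
  stands for missing champions. A gap using it would need a partner beyond the negated sentinel, so
  it rules itself out without any extra test. Champions can be updated when a point arrives but not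
  when one leaves, whereas the suffixes shrink as the line moves right. Hence the champions of all
  prefixes and suffixes are recorded in memory before any line is tested. Absolute jump targets do
  not compose, so the program is compiled from structured commands. Loop-free parts are evaluated
  symbolically, and only loops require invariants.\<close>

datatype guard = ILess nat nat | IEq nat nat | RLess nat nat | CEq nat nat

fun holds :: "guard \<Rightarrow> ram_state \<Rightarrow> bool" where
  "holds (ILess a b) s \<longleftrightarrow> ireg s a < ireg s b"
| "holds (IEq a b) s \<longleftrightarrow> ireg s a = ireg s b"
| "holds (RLess a b) s \<longleftrightarrow> rreg s a < rreg s b"
| "holds (CEq a b) s \<longleftrightarrow> creg s a = creg s b"

fun jump_on :: "guard \<Rightarrow> nat \<Rightarrow> instr" where
  "jump_on (ILess a b) l = JumpILess a b l"
| "jump_on (IEq a b) l = JumpIEq a b l"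
| "jump_on (RLess a b) l = JumpRLess a b l"
| "jump_on (CEq a b) l = JumpCEq a b l"

datatype com = Skip | Op instr | Seq com com (infixr ";;" 60) | Cond guard com com | While guard com

fun code_length :: "com \<Rightarrow> nat" where
  "code_length Skip = 0"
| "code_length (Op i) = 1"
| "code_length (c ;; d) = code_length c + code_length d"
| "code_length (Cond g c d) = code_length c + code_length d + 2"
| "code_length (While g c) = code_length c + 3"

text \<open>Jump targets are absolute, so \<open>b\<close> is the position at which the code will be
  placed. A conditional instruction jumps only on success: hence the else branch comes first, and a
  loop has a second jump at its head for leaving.\<close>

fun compile :: "nat \<Rightarrow> com \<Rightarrow> instr list" where
  "compile b Skip = []"
| "compile b (Op i) = [i]"
| "compile b (c ;; d) = compile b c @ compile (b + code_length c) d"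
| "compile b (Cond g c d) =
     [jump_on g (b + 2 + code_length d)] @ compile (b + 1) d @
     [Jump (b + 2 + code_length d + code_length c)] @ compile (b + 2 + code_length d) c"
| "compile b (While g c) =
     [jump_on g (b + 2), Jump (b + 3 + code_length c)] @ compile (b + 2) c @ [Jump b]"

lemma length_compile [simp]: "length (compile b c) = code_length c"
  by (induction c arbitrary: b) auto

fun straight :: "instr \<Rightarrow> bool" where
  "straight (Jump l) = False"
| "straight (JumpILess a b l) = False"
| "straight (JumpIEq a b l) = False"
| "straight (JumpRLess a b l) = False"
| "straight (JumpREq a b l) = False"
| "straight (JumpCEq a b l) = False"
| "straight (Halt ans) = False"
| "straight _ = True"

fun loop_free :: "com \<Rightarrow> bool" where
  "loop_free Skip = True"
| "loop_free (Op i) = straight i"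
| "loop_free (c ;; d) \<longleftrightarrow> loop_free c \<and> loop_free d"
| "loop_free (Cond g c d) \<longleftrightarrow> loop_free c \<and> loop_free d"
| "loop_free (While g c) = False"

text \<open>The program counter belongs to the compiled code: \<open>ev\<close> leaves it alone, and \<open>ensures\<close> sets it.\<close>

fun ev :: "com \<Rightarrow> ram_state \<Rightarrow> ram_state" where
  "ev Skip s = s"
| "ev (Op i) s = (exec_instr i s)\<lparr>pc := pc s\<rparr>"
| "ev (c ;; d) s = ev d (ev c s)"
| "ev (Cond g c d) s = (if holds g s then ev c s else ev d s)"
| "ev (While g c) s = s"

text \<open>A crude bound, adding both branches of a conditional, is enough for a constant per loop
  round. The value for loops is a placeholder, as \<open>ensures_loop_free\<close> concerns
  loop-free commands only.\<close>

fun cost :: "com \<Rightarrow> nat" where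
  "cost Skip = 0"
| "cost (Op i) = 1"
| "cost (c ;; d) = cost c + cost d"
| "cost (Cond g c d) = cost c + cost d + 2"
| "cost (While g c) = 0"

section \<open>Time-bounded execution of compiled code\<close>

definition reach :: "instr list \<Rightarrow> nat \<Rightarrow> ram_state \<Rightarrow> ram_state \<Rightarrow> bool" where
  "reach prog t s s' \<longleftrightarrow> (\<exists>m\<le>t. (step prog ^^ m) s = s')"

lemma reach_refl: "reach prog t s s"
  unfolding reach_def by (rule exI[of _ 0]) simp

lemma reach_trans:
  assumes "reach prog t s s'" "reach prog t' s' s''"
  shows "reach prog (t + t') s s''"
proof -
  obtain m m' where "m \<le> t" "(step prog ^^ m) s = s'" "m' \<le> t'" "(step prog ^^ m') s' = s''"
    using assms by (auto simp: reach_def)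
  then have "(step prog ^^ (m' + m)) s = s''" "m' + m \<le> t + t'"
    by (simp_all add: funpow_add)
  then show ?thesis unfolding reach_def by blast
qed

lemma reach_mono: "reach prog t s s' \<Longrightarrow> t \<le> t' \<Longrightarrow> reach prog t' s s'"
  unfolding reach_def using le_trans by blast

lemma reach_step: "step prog s = s' \<Longrightarrow> reach prog 1 s s'"
  unfolding reach_def by (rule exI[of _ 1]) simp

text \<open>A total-correctness triple with a time bound. Quantifying over the surrounding code
  \<open>xs\<close> and \<open>ys\<close> makes it composable, and choosing \<open>s'\<close> before
  them makes the result independent of the placement.\<close>

definition ensures :: "com \<Rightarrow> nat \<Rightarrow> ram_state \<Rightarrow> (ram_state \<Rightarrow> bool) \<Rightarrow> bool" where
  "ensures c t s Q \<longleftrightarrow> (\<exists>s'. Q s' \<and> (\<forall>xs ys.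
     reach (xs @ compile (length xs) c @ ys) t
       (s\<lparr>pc := length xs\<rparr>) (s'\<lparr>pc := length xs + code_length c\<rparr>)))"

lemma ensures_mono: "ensures c t s Q \<Longrightarrow> t \<le> t' \<Longrightarrow> (\<And>s'. Q s' \<Longrightarrow> R s') \<Longrightarrow> ensures c t' s R"
  unfolding ensures_def by (meson reach_mono)

lemma ensures_Skip: "Q s \<Longrightarrow> ensures Skip t s Q"
  unfolding ensures_def by (auto intro!: exI[of _ s] reach_refl)

lemma exec_straight:
  "straight i \<Longrightarrow> exec_instr i (s\<lparr>pc := b\<rparr>) = (ev (Op i) s)\<lparr>pc := Suc b\<rparr>"
  by (cases i) (auto simp: next_pc_def)

lemma ensures_Op: "straight i \<Longrightarrow> Q (ev (Op i) s) \<Longrightarrow> ensures (Op i) 1 s Q"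
  unfolding ensures_def
  by (rule exI[of _ "ev (Op i) s"])
    (auto intro!: reach_step[unfolded One_nat_def] simp: step_def exec_straight nth_append simp del: ev.simps)

lemma ensures_Seq:
  assumes "ensures c t s Q" and "\<And>s'. Q s' \<Longrightarrow> ensures d t' s' R"
  shows "ensures (c ;; d) (t + t') s R"
proof -
  obtain s' where s': "Q s'" and c: "\<And>xs ys. reach (xs @ compile (length xs) c @ ys) t
      (s\<lparr>pc := length xs\<rparr>) (s'\<lparr>pc := length xs + code_length c\<rparr>)"
    using assms(1) by (auto simp: ensures_def)
  obtain s'' where s'': "R s''" and d: "\<And>xs ys. reach (xs @ compile (length xs) d @ ys) t'
      (s'\<lparr>pc := length xs\<rparr>) (s''\<lparr>pc := length xs + code_length d\<rparr>)"
    using assms(2)[OF s'] by (auto simp: ensures_def)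
  have "reach (xs @ compile (length xs) (c ;; d) @ ys) (t + t')
      (s\<lparr>pc := length xs\<rparr>) (s''\<lparr>pc := length xs + code_length (c ;; d)\<rparr>)" for xs ys
    using reach_trans[OF c[of xs "compile (length xs + code_length c) d @ ys"]
        d[of "xs @ compile (length xs) c" ys, simplified]]
    by (simp add: add.assoc)
  with s'' show ?thesis unfolding ensures_def by blast
qed

lemma exec_jump_on:
  "exec_instr (jump_on g l) (s\<lparr>pc := b\<rparr>) = s\<lparr>pc := (if holds g s then l else Suc b)\<rparr>"
  by (cases g) (auto simp: jump_if_def next_pc_def)

lemma ensures_Cond:
  assumes "holds g s \<Longrightarrow> ensures c t s Q" and "\<not> holds g s \<Longrightarrow> ensures d t s Q"
  shows "ensures (Cond g c d) (t + 2) s Q"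
proof (cases "holds g s")
  case True
  obtain s' where s': "Q s'" and c: "\<And>xs ys. reach (xs @ compile (length xs) c @ ys) t
      (s\<lparr>pc := length xs\<rparr>) (s'\<lparr>pc := length xs + code_length c\<rparr>)"
    using assms(1)[OF True] by (auto simp: ensures_def)
  have "reach (xs @ compile (length xs) (Cond g c d) @ ys) (1 + t)
      (s\<lparr>pc := length xs\<rparr>) (s'\<lparr>pc := length xs + code_length (Cond g c d)\<rparr>)" for xs ys
  proof (rule reach_trans[OF reach_step[OF refl]])
    let ?b = "length xs"
    \<comment> \<open>Everything compiled before the branch is regarded as its left context, so the
      triple for the branch applies inside the whole program.\<close>
    let ?pre = "xs @ jump_on g (?b + 2 + code_length d) # compile (?b + 1) d @
      [Jump (?b + 2 + code_length d + code_length c)]"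
    have "reach (?pre @ compile (length ?pre) c @ ys) t
        (s\<lparr>pc := length ?pre\<rparr>) (s'\<lparr>pc := length ?pre + code_length c\<rparr>)"
      by (rule c)
    moreover have "length ?pre = ?b + 2 + code_length d" by simp
    ultimately show "reach (xs @ compile ?b (Cond g c d) @ ys) t
        (step (xs @ compile ?b (Cond g c d) @ ys) (s\<lparr>pc := ?b\<rparr>))
        (s'\<lparr>pc := ?b + code_length (Cond g c d)\<rparr>)"
      using True by (simp add: step_def nth_append exec_jump_on algebra_simps)
  qed
  then have "reach (xs @ compile (length xs) (Cond g c d) @ ys) (t + 2)
      (s\<lparr>pc := length xs\<rparr>) (s'\<lparr>pc := length xs + code_length (Cond g c d)\<rparr>)" for xs ys
    by (rule reach_mono) simp
  with s' show ?thesis unfolding ensures_def by blast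
next
  case False
  obtain s' where s': "Q s'" and d: "\<And>xs ys. reach (xs @ compile (length xs) d @ ys) t
      (s\<lparr>pc := length xs\<rparr>) (s'\<lparr>pc := length xs + code_length d\<rparr>)"
    using assms(2)[OF False] by (auto simp: ensures_def)
  have "reach (xs @ compile (length xs) (Cond g c d) @ ys) (1 + (t + 1))
      (s\<lparr>pc := length xs\<rparr>) (s'\<lparr>pc := length xs + code_length (Cond g c d)\<rparr>)" for xs ys
  proof (rule reach_trans[OF reach_step[OF refl] reach_trans[OF _ reach_step]])
    let ?b = "length xs"
    let ?pre = "xs @ [jump_on g (?b + 2 + code_length d)]"
    let ?post = "Jump (?b + 2 + code_length d + code_length c) #
      compile (?b + 2 + code_length d) c @ ys"
    have "reach (?pre @ compile (length ?pre) d @ ?post) t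
        (s\<lparr>pc := length ?pre\<rparr>) (s'\<lparr>pc := length ?pre + code_length d\<rparr>)"
      by (rule d)
    then show "reach (xs @ compile ?b (Cond g c d) @ ys) t
        (step (xs @ compile ?b (Cond g c d) @ ys) (s\<lparr>pc := ?b\<rparr>))
        (s'\<lparr>pc := ?b + 1 + code_length d\<rparr>)"
      using False by (simp add: step_def nth_append exec_jump_on)
    show "step (xs @ compile ?b (Cond g c d) @ ys) (s'\<lparr>pc := ?b + 1 + code_length d\<rparr>) =
        s'\<lparr>pc := ?b + code_length (Cond g c d)\<rparr>"
      by (simp add: step_def nth_append)
  qed
  then have "reach (xs @ compile (length xs) (Cond g c d) @ ys) (t + 2)
      (s\<lparr>pc := length xs\<rparr>) (s'\<lparr>pc := length xs + code_length (Cond g c d)\<rparr>)" for xs ys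
    by (rule reach_mono) simp
  with s' show ?thesis unfolding ensures_def by blast
qed

lemma ensures_While_exit:
  assumes "\<not> holds g s" "Q s"
  shows "ensures (While g c) 2 s Q"
proof -
  have "reach (xs @ compile (length xs) (While g c) @ ys) (1 + 1)
      (s\<lparr>pc := length xs\<rparr>) (s\<lparr>pc := length xs + code_length (While g c)\<rparr>)" for xs ys
    by (rule reach_trans[OF reach_step[OF refl] reach_step])
      (use assms in \<open>simp add: step_def nth_append exec_jump_on\<close>)
  with assms show ?thesis unfolding ensures_def one_add_one by blast
qed

lemma ensures_While_step:
  assumes "holds g s" and "ensures c t s Q" and "\<And>s'. Q s' \<Longrightarrow> ensures (While g c) t' s' R"
  shows "ensures (While g c) (t + 2 + t') s R"
proof -
  obtain s' where s': "Q s'" and c: "\<And>xs ys. reach (xs @ compile (length xs) c @ ys) t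
      (s\<lparr>pc := length xs\<rparr>) (s'\<lparr>pc := length xs + code_length c\<rparr>)"
    using assms(2) by (auto simp: ensures_def)
  obtain s'' where s'': "R s''" and w: "\<And>xs ys. reach (xs @ compile (length xs) (While g c) @ ys) t'
      (s'\<lparr>pc := length xs\<rparr>) (s''\<lparr>pc := length xs + code_length (While g c)\<rparr>)"
    using assms(3)[OF s'] by (auto simp: ensures_def)
  have "reach (xs @ compile (length xs) (While g c) @ ys) (1 + (t + (1 + t')))
      (s\<lparr>pc := length xs\<rparr>) (s''\<lparr>pc := length xs + code_length (While g c)\<rparr>)" for xs ys
  proof (rule reach_trans[OF reach_step[OF refl] reach_trans[OF _ reach_trans[OF reach_step w]]])
    let ?b = "length xs"
    let ?pre = "xs @ [jump_on g (?b + 2), Jump (?b + 3 + code_length c)]"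
    have "reach (?pre @ compile (length ?pre) c @ Jump ?b # ys) t
        (s\<lparr>pc := length ?pre\<rparr>) (s'\<lparr>pc := length ?pre + code_length c\<rparr>)"
      by (rule c)
    then show "reach (xs @ compile ?b (While g c) @ ys) t
        (step (xs @ compile ?b (While g c) @ ys) (s\<lparr>pc := ?b\<rparr>))
        (s'\<lparr>pc := ?b + 2 + code_length c\<rparr>)"
      using assms(1) by (simp add: step_def nth_append exec_jump_on)
    show "step (xs @ compile ?b (While g c) @ ys) (s'\<lparr>pc := ?b + 2 + code_length c\<rparr>) =
        s'\<lparr>pc := ?b\<rparr>"
      by (simp add: step_def nth_append)
  qed
  moreover have "1 + (t + (1 + t')) = t + 2 + t'" by simp
  ultimately show ?thesis using s'' unfolding ensures_def by metis
qed

text \<open>The index of \<open>I\<close> is a variant bounding the rounds still to come. Each round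
  pays 2 extra steps for the test and the jump back, and the exit pays 2 for the failed test and the
  jump out.\<close>

lemma ensures_While:
  assumes "I k s"
    and "\<And>k s. I k s \<Longrightarrow> holds g s \<Longrightarrow> ensures c t s (\<lambda>s'. \<exists>k'<k. I k' s')"
    and "\<And>k s. I k s \<Longrightarrow> \<not> holds g s \<Longrightarrow> Q s"
  shows "ensures (While g c) (k * (t + 2) + 2) s Q"
  using assms(1)
proof (induction k arbitrary: s rule: less_induct)
  case (less k)
  show ?case
  proof (cases "holds g s")
    case False
    then show ?thesis
      using ensures_mono[OF ensures_While_exit[of g s Q c]] assms(3)[OF less.prems] by simp
  next
    case True
    \<comment> \<open>The body would have to ensure an index below \<open>k\<close>, which is
      impossible for \<open>k = 0\<close>.\<close>
    have k: "0 < k"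
      using assms(2)[OF less.prems True] by (auto simp: ensures_def)
    have "ensures (While g c) (t + 2 + ((k - 1) * (t + 2) + 2)) s Q"
    proof (rule ensures_While_step[OF True assms(2)[OF less.prems True]])
      fix s' assume "\<exists>k'<k. I k' s'"
      then obtain k' where k': "k' < k" "I k' s'" by blast
      then have "k' * (t + 2) \<le> (k - 1) * (t + 2)" by (intro mult_le_mono1) simp
      then show "ensures (While g c) ((k - 1) * (t + 2) + 2) s' Q"
        using ensures_mono[OF less.IH[OF k']] by simp
    qed
    moreover have "t + 2 + ((k - 1) * (t + 2) + 2) = k * (t + 2) + 2"
      using k by (cases k) simp_all
    ultimately show ?thesis by simp
  qed
qed

text \<open>Turns the verification of a loop body into the evaluation of \<open>ev\<close>, which
  the simplifier can carry out.\<close>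

lemma ensures_loop_free:
  assumes "loop_free c" and "Q (ev c s)"
  shows "ensures c (cost c) s Q"
  using assms
proof (induction c arbitrary: s Q)
  case Skip
  then show ?case by (simp add: ensures_Skip)
next
  case (Op i)
  then show ?case using ensures_Op[of i Q s] by simp
next
  case (Seq c d)
  have "ensures c (cost c) s (\<lambda>s'. s' = ev c s)"
    using Seq by simp
  then have "ensures (c ;; d) (cost c + cost d) s Q"
    by (rule ensures_Seq) (use Seq in simp)
  then show ?case by simp
next
  case (Cond g c d)
  have "ensures (Cond g c d) (cost c + cost d + 2) s Q"
    by (rule ensures_Cond; rule ensures_mono) (use Cond in auto)
  then show ?case by simp
qed simp

lemma ev_Op [simp]:
  "ev (Op (IConst d n)) s = s\<lparr>ireg := (ireg s)(d := n)\<rparr>"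
  "ev (Op (IMove d a)) s = s\<lparr>ireg := (ireg s)(d := ireg s a)\<rparr>"
  "ev (Op (IAdd d a b)) s = s\<lparr>ireg := (ireg s)(d := ireg s a + ireg s b)\<rparr>"
  "ev (Op (ISub d a b)) s = s\<lparr>ireg := (ireg s)(d := ireg s a - ireg s b)\<rparr>"
  "ev (Op (ILoad d a)) s = s\<lparr>ireg := (ireg s)(d := imem s (ireg s a))\<rparr>"
  "ev (Op (IStore a b)) s = s\<lparr>imem := (imem s)(ireg s a := ireg s b)\<rparr>"
  "ev (Op (RConst d z)) s = s\<lparr>rreg := (rreg s)(d := real_of_int z)\<rparr>"
  "ev (Op (RMove d a)) s = s\<lparr>rreg := (rreg s)(d := rreg s a)\<rparr>"
  "ev (Op (RSub d a b)) s = s\<lparr>rreg := (rreg s)(d := rreg s a - rreg s b)\<rparr>"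
  "ev (Op (RMul d a b)) s = s\<lparr>rreg := (rreg s)(d := rreg s a * rreg s b)\<rparr>"
  "ev (Op (RLoad d a)) s = s\<lparr>rreg := (rreg s)(d := rmem s (ireg s a))\<rparr>"
  "ev (Op (RStore a b)) s = s\<lparr>rmem := (rmem s)(ireg s a := rreg s b)\<rparr>"
  "ev (Op (CMove d a)) s = s\<lparr>creg := (creg s)(d := creg s a)\<rparr>"
  "ev (Op (CLoad d a)) s = s\<lparr>creg := (creg s)(d := cmem s (ireg s a))\<rparr>"
  "ev (Op (CStore a b)) s = s\<lparr>cmem := (cmem s)(ireg s a := creg s b)\<rparr>"
  by (simp_all add: next_pc_def)

declare ev.simps(2) [simp del]

fun seqs :: "com list \<Rightarrow> com" where
  "seqs [] = Skip"
| "seqs (c # cs) = c ;; seqs cs"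

abbreviation ops :: "instr list \<Rightarrow> com" where
  "ops is \<equiv> seqs (map Op is)"

lemma loop_free_seqs [simp]: "loop_free (seqs cs) \<longleftrightarrow> (\<forall>c\<in>set cs. loop_free c)"
  by (induction cs) auto

section \<open>Champions\<close>

fun bubble :: "real \<times> nat \<Rightarrow> (real \<times> nat) list \<Rightarrow> (real \<times> nat) list" where
  "bubble p [] = []"
| "bubble p (l # ls) = (if fst l < fst p then p # bubble l ls else l # bubble p ls)"

lemma length_bubble [simp]: "length (bubble p ls) = length ls"
  by (induction ls arbitrary: p) auto

text \<open>At every slot the larger entry stays and the smaller one is carried on. The carried
  entry is thus always the least so far, whatever the order of the list.\<close>

lemma bubble_drops_min:
  "\<exists>m. mset (m # bubble p ls) = mset (p # ls) \<and> fst m \<le> fst p \<and> (\<forall>l\<in>set (bubble p ls). fst m \<le> fst l)"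
proof (induction ls arbitrary: p)
  case (Cons l ls)
  show ?case
  proof (cases "fst l < fst p")
    case True
    obtain m where "mset (m # bubble l ls) = mset (l # ls)" "fst m \<le> fst l"
      "\<forall>l'\<in>set (bubble l ls). fst m \<le> fst l'"
      using Cons.IH by blast
    with True show ?thesis by (intro exI[of _ m]) (auto simp: add_mset_commute)
  next
    case False
    obtain m where "mset (m # bubble p ls) = mset (p # ls)" "fst m \<le> fst p"
      "\<forall>l'\<in>set (bubble p ls). fst m \<le> fst l'"
      using Cons.IH by blast
    with False show ?thesis by (intro exI[of _ m]) (auto simp: add_mset_commute)
  qed
qed simp

text \<open>The test \<open>M < fst l\<close> recognizes occupied slots: the color in an empty slot
  is a mere default and must not count as an occurrence of that color.\<close>

definition insert_champion ::
  "real \<Rightarrow> real \<times> nat \<Rightarrow> (real \<times> nat) list \<Rightarrow> (real \<times> nat) list" where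
  "insert_champion M p ls =
     (if \<exists>l\<in>set ls. snd l = snd p \<and> M < fst l
      then map (\<lambda>l. if snd l = snd p \<and> M < fst l \<and> fst l < fst p then p else l) ls
      else bubble p ls)"

lemma length_insert_champion [simp]: "length (insert_champion M p ls) = length ls"
  by (simp add: insert_champion_def)

text \<open>The last conjunct is the exchange property itself, with \<open>F\<close> as the colors
  of the other three points. When \<open>S\<close> lies above \<open>M\<close>, the height condition
  also forces the entry found there to be occupied.\<close>

definition champions :: "real \<Rightarrow> (real \<times> nat) set \<Rightarrow> (real \<times> nat) list \<Rightarrow> bool" where
  "champions M S ls \<longleftrightarrow> length ls = 4 \<and> (\<forall>l\<in>set ls. M < fst l \<longrightarrow> l \<in> S) \<and>
     distinct (map snd (filter (\<lambda>l. M < fst l) ls)) \<and>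
     (\<forall>q\<in>S. \<forall>F. finite F \<longrightarrow> card F \<le> 3 \<longrightarrow> snd q \<notin> F \<longrightarrow>
        (\<exists>l\<in>set ls. fst q \<le> fst l \<and> snd l \<notin> F))"

lemma champions_empty: "champions M {} (replicate 4 (M, c))"
  by (simp add: champions_def)

lemma champions_insert:
  assumes ch: "champions M S ls" and S: "\<And>q. q \<in> S \<Longrightarrow> M < fst q" and p: "M < fst p"
  shows "champions M (insert p S) (insert_champion M p ls)"
proof (cases "\<exists>l\<in>set ls. snd l = snd p \<and> M < fst l")
  case True
  let ?f = "\<lambda>l. if snd l = snd p \<and> M < fst l \<and> fst l < fst p then p else l"
  have f: "insert_champion M p ls = map ?f ls"
    using True by (simp add: insert_champion_def)
  \<comment> \<open>Raising an entry changes neither its color nor whether its slot is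
    occupied.\<close>
  have "map snd (filter (\<lambda>l. M < fst l) (map ?f ls)) = map snd (filter (\<lambda>l. M < fst l) ls)"
    using p by (induction ls) auto
  moreover have "\<exists>l\<in>set (map ?f ls). fst q \<le> fst l \<and> snd l \<notin> F"
    if q: "q \<in> insert p S" and F: "finite F" "card F \<le> 3" "snd q \<notin> F" for q F
  proof (cases "q = p")
    case True
    obtain l where "l \<in> set ls" "snd l = snd p" "M < fst l"
      using \<open>\<exists>l\<in>set ls. snd l = snd p \<and> M < fst l\<close> by blast
    with True F show ?thesis by (intro bexI[of _ "?f l"]) auto
  next
    case False
    then obtain l where "l \<in> set ls" "fst q \<le> fst l" "snd l \<notin> F"
      using ch q F unfolding champions_def by blast
    then show ?thesis by (intro bexI[of _ "?f l"]) auto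
  qed
  ultimately show ?thesis
    using ch p unfolding f champions_def by auto
next
  case False
  let ?ls = "bubble p ls"
  have f: "insert_champion M p ls = ?ls"
    using False by (auto simp: insert_champion_def)
  obtain m where m: "mset (m # ?ls) = mset (p # ls)" "\<And>l. l \<in> set ?ls \<Longrightarrow> fst m \<le> fst l"
    using bubble_drops_min by blast
  have set: "insert m (set ?ls) = insert p (set ls)"
    using m(1) by (metis list.simps(15) set_mset_mset)
  \<comment> \<open>The color of \<open>p\<close> is missing among the occupied slots, so all
    occupied candidates, \<open>p\<close> included, have different colors. This survives dropping
    one of them.\<close>
  have "distinct (map snd (filter (\<lambda>l. M < fst l) (p # ls)))"
    using ch p False by (auto simp: champions_def)
  moreover have "mset (map snd (filter (\<lambda>l. M < fst l) (m # ?ls))) =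
      mset (map snd (filter (\<lambda>l. M < fst l) (p # ls)))"
    using m(1) by (simp only: mset_map mset_filter)
  ultimately have dm: "distinct (map snd (filter (\<lambda>l. M < fst l) (m # ?ls)))"
    using mset_eq_imp_distinct_iff by blast
  then have d: "distinct (map snd (filter (\<lambda>l. M < fst l) ?ls))"
    by (auto split: if_splits)
  have "\<exists>l\<in>set ?ls. fst q \<le> fst l \<and> snd l \<notin> F"
    if q: "q \<in> insert p S" and F: "finite F" "card F \<le> 3" "snd q \<notin> F" for q F
  proof -
    have "\<exists>l\<in>insert p (set ls). fst q \<le> fst l \<and> snd l \<notin> F"
      using ch q F unfolding champions_def by blast
    then obtain l where l: "l \<in> insert m (set ?ls)" "fst q \<le> fst l" "snd l \<notin> F"
      unfolding set by blast
    show ?thesis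
    proof (cases "l = m")
      case True
      \<comment> \<open>All four remaining champions beat the dropped one, and three colors cannot exclude them all.\<close>
      have "M < fst q" using q S p by blast
      then have "filter (\<lambda>l. M < fst l) ?ls = ?ls"
        using m(2) l(2) True by (intro filter_True) fastforce
      with d have "distinct (map snd ?ls)" by simp
      then have "card (snd ` set ?ls) = 4"
        using ch by (metis champions_def distinct_card length_bubble length_map set_map)
      then have "\<not> snd ` set ?ls \<subseteq> F"
        using F(2) card_mono[OF F(1), of "snd ` set ?ls"] by linarith
      then obtain l' where l': "l' \<in> set ?ls" "snd l' \<notin> F" by blast
      then show ?thesis using m(2)[OF l'(1)] l(2) True by (intro bexI[of _ l']) auto
    qed (use l in blast)
  qed
  moreover have "l \<in> insert p S" if "l \<in> set ?ls" "M < fst l" for l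
    using ch that set unfolding champions_def by blast
  ultimately show ?thesis
    using ch d unfolding f champions_def by simp
qed

lemma champions_fold:
  assumes "\<And>q. q \<in> set ps \<Longrightarrow> M < fst q"
  shows "champions M (set ps) (fold (insert_champion M) ps (replicate 4 (M, c)))"
  using assms
proof (induction ps rule: rev_induct)
  case (snoc p ps)
  then show ?case using champions_insert[of M "set ps" _ p] by simp
qed (simp add: champions_empty)

text \<open>\<open>a\<close> and \<open>c\<close> are the upper points on the left and right;
  \<open>b\<close> and \<open>d\<close> are the lower ones, stored with \<open>y\<close> negated. In
  this form the condition is monotone in all four heights, so one notion of champion serves top and
  bottom.\<close>

definition rainbow_gap :: "real \<times> nat \<Rightarrow> real \<times> nat \<Rightarrow> real \<times> nat \<Rightarrow> real \<times> nat \<Rightarrow> bool" where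
  "rainbow_gap a b c d \<longleftrightarrow> distinct [snd a, snd b, snd c, snd d] \<and>
     - fst b < fst a \<and> - fst d < fst a \<and> - fst b < fst c \<and> - fst d < fst c"

lemma champions_replace:
  assumes "champions M S ls" "q \<in> S" "snd q \<notin> {a, b, c}"
  shows "\<exists>l\<in>set ls. fst q \<le> fst l \<and> snd l \<notin> {a, b, c}"
proof -
  have "card {a, b, c} \<le> 3" by (simp add: card_insert_if)
  then show ?thesis
    using assms unfolding champions_def by (meson finite.emptyI finite.insertI)
qed

text \<open>Left to right, the four points are replaced in turn, the forbidden colors always being
  those of the current other three; heights only grow, so the gap persists. Right to left, it must
  be seen that no empty slot takes part.\<close>

lemma rainbow_gap_champions:
  assumes ch: "champions M A as" "champions M B bs" "champions M C cs" "champions M D ds"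
    and bounds: "\<And>q. q \<in> A \<union> B \<union> C \<union> D \<Longrightarrow> M < fst q \<and> fst q < - M"
    and M: "M < 0"
  shows "(\<exists>a\<in>A. \<exists>b\<in>B. \<exists>c\<in>C. \<exists>d\<in>D. rainbow_gap a b c d) \<longleftrightarrow>
    (\<exists>a\<in>set as. \<exists>b\<in>set bs. \<exists>c\<in>set cs. \<exists>d\<in>set ds. rainbow_gap a b c d)"
proof
  assume "\<exists>a\<in>A. \<exists>b\<in>B. \<exists>c\<in>C. \<exists>d\<in>D. rainbow_gap a b c d"
  then obtain a b c d where abcd: "a \<in> A" "b \<in> B" "c \<in> C" "d \<in> D" and r: "rainbow_gap a b c d"
    by blast
  obtain a' where a': "a' \<in> set as" "fst a \<le> fst a'" "snd a' \<notin> {snd b, snd c, snd d}"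
    using champions_replace[OF ch(1) abcd(1), of "snd b" "snd c" "snd d"] r unfolding rainbow_gap_def by auto
  then have r: "rainbow_gap a' b c d" using r by (auto simp: rainbow_gap_def)
  obtain b' where b': "b' \<in> set bs" "fst b \<le> fst b'" "snd b' \<notin> {snd a', snd c, snd d}"
    using champions_replace[OF ch(2) abcd(2), of "snd a'" "snd c" "snd d"] r
    unfolding rainbow_gap_def by auto
  then have r: "rainbow_gap a' b' c d" using r by (auto simp: rainbow_gap_def)
  obtain c' where c': "c' \<in> set cs" "fst c \<le> fst c'" "snd c' \<notin> {snd a', snd b', snd d}"
    using champions_replace[OF ch(3) abcd(3), of "snd a'" "snd b'" "snd d"] r
    unfolding rainbow_gap_def by auto
  then have r: "rainbow_gap a' b' c' d" using r by (auto simp: rainbow_gap_def)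
  obtain d' where d': "d' \<in> set ds" "fst d \<le> fst d'" "snd d' \<notin> {snd a', snd b', snd c'}"
    using champions_replace[OF ch(4) abcd(4), of "snd a'" "snd b'" "snd c'"] r
    unfolding rainbow_gap_def by auto
  then have "rainbow_gap a' b' c' d'" using r by (auto simp: rainbow_gap_def)
  with a' b' c' d' show "\<exists>a\<in>set as. \<exists>b\<in>set bs. \<exists>c\<in>set cs. \<exists>d\<in>set ds. rainbow_gap a b c d"
    by blast
next
  assume "\<exists>a\<in>set as. \<exists>b\<in>set bs. \<exists>c\<in>set cs. \<exists>d\<in>set ds. rainbow_gap a b c d"
  then obtain a b c d where abcd: "a \<in> set as" "b \<in> set bs" "c \<in> set cs" "d \<in> set ds"
    and r: "rainbow_gap a b c d" by blast
  have real: "l \<in> S" if "champions M S ls" "l \<in> set ls" "M < fst l" for S ls l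
    using that unfolding champions_def by blast
  have lt: "fst l < - M" if "champions M S ls" "S \<subseteq> A \<union> B \<union> C \<union> D" "l \<in> set ls" for S ls l
    using bounds[of l] real[OF that(1,3)] that(2) M by (cases "M < fst l") auto
  have "fst a < - M" "fst b < - M" "fst c < - M" "fst d < - M"
    using lt[OF ch(1) _ abcd(1)] lt[OF ch(2) _ abcd(2)] lt[OF ch(3) _ abcd(3)] lt[OF ch(4) _ abcd(4)]
    by blast+
  \<comment> \<open>For example \<open>- fst b < fst a\<close> together with
    \<open>fst b < - M\<close> gives \<open>M < fst a\<close>: every entry has a partner on the
    opposite level that proves it occupied.\<close>
  then have "M < fst a" "M < fst b" "M < fst c" "M < fst d"
    using r unfolding rainbow_gap_def by linarith+
  then show "\<exists>a\<in>A. \<exists>b\<in>B. \<exists>c\<in>C. \<exists>d\<in>D. rainbow_gap a b c d"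
    using r real[OF ch(1) abcd(1)] real[OF ch(2) abcd(2)] real[OF ch(3) abcd(3)] real[OF ch(4) abcd(4)]
    by blast
qed

section \<open>Crosses as gaps at a split of the sorted sequence\<close>

lemma cross_iff_split:
  fixes pt :: "nat \<Rightarrow> real \<times> real"
  assumes P: "pt ` {..<n} = P" and sorted: "\<And>u v. u \<le> v \<Longrightarrow> v < n \<Longrightarrow> fst (pt u) \<le> fst (pt v)"
  shows "contains_four_colored_cross P col \<longleftrightarrow>
    (\<exists>t. Suc t < n \<and> fst (pt t) < fst (pt (Suc t)) \<and>
      (\<exists>a\<in>(\<lambda>p. (snd p, col p)) ` pt ` {..t}. \<exists>b\<in>(\<lambda>p. (- snd p, col p)) ` pt ` {..t}.
       \<exists>c\<in>(\<lambda>p. (snd p, col p)) ` pt ` {Suc t..<n}. \<exists>d\<in>(\<lambda>p. (- snd p, col p)) ` pt ` {Suc t..<n}.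
         rainbow_gap a b c d))" (is "_ \<longleftrightarrow> ?R")
proof
  assume "contains_four_colored_cross P col"
  then obtain c p q r s where c: "p \<in> P" "p \<in> NE_quadrant c" "q \<in> P" "q \<in> NW_quadrant c"
    "r \<in> P" "r \<in> SW_quadrant c" "s \<in> P" "s \<in> SE_quadrant c" "distinct [col p, col q, col r, col s]"
    unfolding contains_four_colored_cross_def by blast
  obtain ip iq ir is' where i: "ip < n" "p = pt ip" "iq < n" "q = pt iq" "ir < n" "r = pt ir"
    "is' < n" "s = pt is'"
    using c P by blast
  define L where "L = {u. u < n \<and> fst (pt u) < fst c}"
  \<comment> \<open>The split goes after the last point strictly left of the center of the
    cross.\<close>
  define t where "t = Max L"
  have "finite L" by (simp add: L_def)
  moreover have mem: "iq \<in> L" "ir \<in> L" using c i by (auto simp: L_def NW_quadrant_def SW_quadrant_def)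
  ultimately have t: "t \<in> L" and max: "\<And>u. u \<in> L \<Longrightarrow> u \<le> t"
    unfolding t_def by (auto intro: Max_in)
  have right: "t < u" if "u < n" "fst c < fst (pt u)" for u
    using sorted[of u t] t that unfolding L_def by fastforce
  have "t < ip" "t < is'" using right c i by (auto simp: NE_quadrant_def SE_quadrant_def)
  then have "Suc t < n" using i by simp
  \<comment> \<open>The next point may lie on the vertical line through the center; not being left
    of it already makes the step in \<open>x\<close> strict.\<close>
  moreover have "\<not> Suc t \<in> L" using max by force
  ultimately have "fst (pt t) < fst (pt (Suc t))" using t by (auto simp: L_def)
  moreover have "rainbow_gap (snd q, col q) (- snd r, col r) (snd p, col p) (- snd s, col s)"
    using c by (auto simp: rainbow_gap_def NE_quadrant_def NW_quadrant_def SW_quadrant_def SE_quadrant_def)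
  moreover have "q \<in> pt ` {..t}" "r \<in> pt ` {..t}" "p \<in> pt ` {Suc t..<n}" "s \<in> pt ` {Suc t..<n}"
    using i mem max \<open>t < ip\<close> \<open>t < is'\<close> by auto
  ultimately show ?R using \<open>Suc t < n\<close> by blast
next
  assume ?R
  then obtain t q r p s where t: "Suc t < n" "fst (pt t) < fst (pt (Suc t))"
    and m: "q \<in> pt ` {..t}" "r \<in> pt ` {..t}" "p \<in> pt ` {Suc t..<n}" "s \<in> pt ` {Suc t..<n}"
    and g: "rainbow_gap (snd q, col q) (- snd r, col r) (snd p, col p) (- snd s, col s)"
    by blast
  \<comment> \<open>The center lies halfway between the two abscissas at the split, and halfway
    between the lower of the upper points and the higher of the lower points.\<close>
  define c where "c = ((fst (pt t) + fst (pt (Suc t))) / 2, (min (snd p) (snd q) + max (snd r) (snd s)) / 2)"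
  have "fst u \<le> fst (pt t)" if "u \<in> pt ` {..t}" for u
    using sorted[of _ t] t(1) that by fastforce
  moreover have "fst (pt (Suc t)) \<le> fst u" if "u \<in> pt ` {Suc t..<n}" for u
    using sorted[of "Suc t"] that by fastforce
  ultimately have "fst q \<le> fst (pt t)" "fst r \<le> fst (pt t)" "fst (pt (Suc t)) \<le> fst p" "fst (pt (Suc t)) \<le> fst s"
    using m by blast+
  then have x: "fst q < fst c" "fst r < fst c" "fst c < fst p" "fst c < fst s"
    using t unfolding c_def by simp_all
  have "max (snd r) (snd s) < min (snd p) (snd q)" using g by (auto simp: rainbow_gap_def)
  moreover have "(b + a) / 2 < b \<and> a < (b + a) / 2" if "a < b" for a b :: real
    using that by simp
  ultimately have y: "snd c < min (snd p) (snd q)" "max (snd r) (snd s) < snd c"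
    unfolding c_def snd_conv by blast+
  have "p \<in> P \<inter> NE_quadrant c" "q \<in> P \<inter> NW_quadrant c" "r \<in> P \<inter> SW_quadrant c" "s \<in> P \<inter> SE_quadrant c"
    using m P t x y by (auto simp: NE_quadrant_def NW_quadrant_def SW_quadrant_def SE_quadrant_def)
  moreover have "distinct [col p, col q, col r, col s]" using g by (auto simp: rainbow_gap_def)
  ultimately show "contains_four_colored_cross P col"
    unfolding contains_four_colored_cross_def by blast
qed

section \<open>Merging\<close>

definition sorted_blocks :: "('a \<Rightarrow> real) \<Rightarrow> nat \<Rightarrow> nat \<Rightarrow> (nat \<Rightarrow> 'a) \<Rightarrow> bool" where
  "sorted_blocks key d k Y \<longleftrightarrow> (\<forall>u v. u < v \<longrightarrow> v < k \<longrightarrow> u div d = v div d \<longrightarrow> key (Y u) \<le> key (Y v))"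

text \<open>The loop invariant of bottom-up merging: the runs starting at \<open>lo\<close> and
  \<open>lo + w\<close> are partly consumed, with \<open>i..<ie\<close> and \<open>j..<je\<close>
  remaining and \<open>k\<close> values written. The minima clip the last runs, possibly to nothing.
  The final conjunct says that whatever remains may be appended to the current block.\<close>

definition merging :: "('a \<Rightarrow> real) \<Rightarrow> nat \<Rightarrow> nat \<Rightarrow> (nat \<Rightarrow> 'a) \<Rightarrow>
    nat \<Rightarrow> nat \<Rightarrow> nat \<Rightarrow> nat \<Rightarrow> nat \<Rightarrow> (nat \<Rightarrow> 'a) \<Rightarrow> bool" where
  "merging key n w X i ie j je k Y \<longleftrightarrow> (\<exists>m lo. lo = m * (2 * w) \<and> lo \<le> i \<and> i \<le> ie \<and> ie \<le> j \<and> j \<le> je \<and>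
     ie = min (lo + w) n \<and> je = min (lo + 2 * w) n \<and> k + ie = i + j \<and>
     Y ` {..<k} = X ` {..<i} \<union> X ` {ie..<j} \<and> sorted_blocks key (2 * w) k Y \<and>
     (\<forall>u\<in>{lo..<k}. \<forall>v\<in>{i..<ie} \<union> {j..<je}. key (Y u) \<le> key (X v)))"

lemma merging_start:
  "merging key n w X 0 (min w n) (min w n) (min (min w n + w) n) 0 Y"
  unfolding merging_def sorted_blocks_def by (intro exI[of _ 0]) auto

lemma merging_next:
  assumes "merging key n w X i i j j k Y" "k < n"
  shows "merging key n w X j (min (j + w) n) (min (j + w) n) (min (min (j + w) n + w) n) k Y"
proof -
  obtain m where h: "m * (2 * w) \<le> i" "i \<le> j" "i = min (m * (2 * w) + w) n" "j = min (m * (2 * w) + 2 * w) n"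
    "k = j" "Y ` {..<k} = X ` {..<i} \<union> X ` {i..<j}" "sorted_blocks key (2 * w) k Y"
    using assms(1) unfolding merging_def by auto
  have "{..<j} = {..<i} \<union> {i..<j}" using h(2) by auto
  then have "Y ` {..<k} = X ` {..<j}" using h(6) by (metis image_Un)
  \<comment> \<open>Since \<open>j = k < n\<close>, the second run was not clipped at
    \<open>n\<close>, so the next pair begins at a full multiple of \<open>2 * w\<close>.\<close>
  moreover have "j = Suc m * (2 * w)" using h assms(2) by simp
  moreover have "min (min (j + w) n + w) n = min (j + 2 * w) n" by simp
  ultimately show ?thesis
    unfolding merging_def using h(5,7) assms(2)
    by (intro exI[of _ "Suc m"] exI[of _ j] conjI) (simp_all del: mult_Suc)
qed

lemma sorted_blocks_snoc:
  assumes "sorted_blocks key d k Y" "\<And>u. u < k \<Longrightarrow> u div d = k div d \<Longrightarrow> key (Y u) \<le> key x"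
  shows "sorted_blocks key d (Suc k) (Y(k := x))"
  using assms unfolding sorted_blocks_def by (auto simp: less_Suc_eq)

lemma div_block_lower:
  fixes d :: nat
  assumes "u div d = k div d" "m * d \<le> k" "0 < d"
  shows "m * d \<le> u"
  using assms by (metis less_eq_div_iff_mult_less_eq)

lemma fun_upd_image_lessThan_Suc: "(Y(k := x)) ` {..<Suc k} = insert x (Y ` {..<k})"
  by auto

lemma merging_left:
  assumes "merging key n w X i ie j je k Y" and X: "sorted_blocks key w n X" and w: "0 < w"
    and i: "i < ie" and le: "j < je \<Longrightarrow> key (X i) \<le> key (X j)"
  shows "merging key n w X (Suc i) ie j je (Suc k) (Y(k := X i))"
proof -
  obtain m where h: "m * (2 * w) \<le> i" "ie \<le> j" "j \<le> je" "ie = min (m * (2 * w) + w) n"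
    "je = min (m * (2 * w) + 2 * w) n" "k + ie = i + j" "Y ` {..<k} = X ` {..<i} \<union> X ` {ie..<j}"
    "sorted_blocks key (2 * w) k Y"
    "\<And>u v. m * (2 * w) \<le> u \<Longrightarrow> u < k \<Longrightarrow> v \<in> {i..<ie} \<union> {j..<je} \<Longrightarrow> key (Y u) \<le> key (X v)"
    using assms(1) unfolding merging_def by auto
  \<comment> \<open>The two runs are the consecutive \<open>w\<close>-blocks \<open>2 * m\<close>
    and \<open>2 * m + 1\<close> of the source, so sortedness of the source applies inside
    each.\<close>
  have block1: "v div w = 2 * m" if "m * (2 * w) \<le> v" "v < ie" for v
    by (rule div_nat_eqI) (use h that in \<open>auto simp: algebra_simps\<close>)
  have block2: "v div w = 2 * m + 1" if "m * (2 * w) + w \<le> v" "v < je" for v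
    by (rule div_nat_eqI) (use h that in \<open>auto simp: algebra_simps\<close>)
  have next1: "key (X i) \<le> key (X v)" if "i \<le> v" "v < ie" for v
    using X that h(1,4) i block1[of i] block1[of v] unfolding sorted_blocks_def
    by (cases "i = v") auto
  have next2: "key (X i) \<le> key (X v)" if "j \<le> v" "v < je" for v
  proof -
    \<comment> \<open>As the second run is not exhausted, the first one cannot have been clipped at
      \<open>n\<close>.\<close>
    have "m * (2 * w) + w \<le> j" using that h(2,4,5) by auto
    then have "key (X j) \<le> key (X v)"
      using X that h(5) block2[of j] block2[of v] unfolding sorted_blocks_def
      by (cases "j = v") auto
    then show ?thesis using le that by force
  qed
  have "sorted_blocks key (2 * w) (Suc k) (Y(k := X i))"
  proof (rule sorted_blocks_snoc[OF h(8)])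
    \<comment> \<open>A position in the same block as \<open>k\<close> is not before
      \<open>lo\<close>, so the final conjunct of the invariant covers it.\<close>
    fix u assume u: "u < k" "u div (2 * w) = k div (2 * w)"
    have "m * (2 * w) \<le> k" using h(1,2,6) by linarith
    then have "m * (2 * w) \<le> u" using div_block_lower[OF u(2)] w by simp
    then show "key (Y u) \<le> key (X i)" using h(9) u(1) i by auto
  qed
  moreover have "(Y(k := X i)) ` {..<Suc k} = X ` {..<Suc i} \<union> X ` {ie..<j}"
    using h(7) unfolding fun_upd_image_lessThan_Suc by (simp add: lessThan_Suc)
  moreover have "\<forall>u\<in>{m * (2 * w)..<Suc k}. \<forall>v\<in>{Suc i..<ie} \<union> {j..<je}.
      key ((Y(k := X i)) u) \<le> key (X v)"
    using h(9) next1 next2 by (auto simp: less_Suc_eq)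
  ultimately show ?thesis
    unfolding merging_def using h(1-3,6) i
    by (intro exI[of _ m] exI[of _ "m * (2 * w)"] conjI) (rule refl h(4,5) | assumption | linarith)+
qed

lemma merging_right:
  assumes "merging key n w X i ie j je k Y" and X: "sorted_blocks key w n X" and w: "0 < w"
    and j: "j < je" and le: "i < ie \<Longrightarrow> key (X j) \<le> key (X i)"
  shows "merging key n w X i ie (Suc j) je (Suc k) (Y(k := X j))"
proof -
  obtain m where h: "m * (2 * w) \<le> i" "i \<le> ie" "ie \<le> j" "ie = min (m * (2 * w) + w) n"
    "je = min (m * (2 * w) + 2 * w) n" "k + ie = i + j" "Y ` {..<k} = X ` {..<i} \<union> X ` {ie..<j}"
    "sorted_blocks key (2 * w) k Y"
    "\<And>u v. m * (2 * w) \<le> u \<Longrightarrow> u < k \<Longrightarrow> v \<in> {i..<ie} \<union> {j..<je} \<Longrightarrow> key (Y u) \<le> key (X v)"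
    using assms(1) unfolding merging_def by auto
  have block1: "v div w = 2 * m" if "m * (2 * w) \<le> v" "v < ie" for v
    by (rule div_nat_eqI) (use h that in \<open>auto simp: algebra_simps\<close>)
  have block2: "v div w = 2 * m + 1" if "m * (2 * w) + w \<le> v" "v < je" for v
    by (rule div_nat_eqI) (use h that in \<open>auto simp: algebra_simps\<close>)
  have next1: "key (X j) \<le> key (X v)" if "i \<le> v" "v < ie" for v
  proof -
    have "key (X i) \<le> key (X v)"
      using X that h(1,4) block1[of i] block1[of v] unfolding sorted_blocks_def
      by (cases "i = v") auto
    then show ?thesis using le that by force
  qed
  have next2: "key (X j) \<le> key (X v)" if "j \<le> v" "v < je" for v
  proof -
    have "m * (2 * w) + w \<le> j" using that h(3,4,5) by auto
    then show ?thesis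
      using X that h(5) block2[of j] block2[of v] unfolding sorted_blocks_def
      by (cases "j = v") auto
  qed
  have "sorted_blocks key (2 * w) (Suc k) (Y(k := X j))"
  proof (rule sorted_blocks_snoc[OF h(8)])
    fix u assume u: "u < k" "u div (2 * w) = k div (2 * w)"
    have "m * (2 * w) \<le> k" using h(1,3,6) by linarith
    then have "m * (2 * w) \<le> u" using div_block_lower[OF u(2)] w by simp
    then show "key (Y u) \<le> key (X j)" using h(9) u(1) j by auto
  qed
  moreover have "(Y(k := X j)) ` {..<Suc k} = X ` {..<i} \<union> X ` {ie..<Suc j}"
    using h(3,7) unfolding fun_upd_image_lessThan_Suc by (simp add: atLeastLessThanSuc)
  moreover have "\<forall>u\<in>{m * (2 * w)..<Suc k}. \<forall>v\<in>{i..<ie} \<union> {Suc j..<je}.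
      key ((Y(k := X j)) u) \<le> key (X v)"
    using h(9) next1 next2 by (auto simp: less_Suc_eq)
  ultimately show ?thesis
    unfolding merging_def using h(1-3,6) j
    by (intro exI[of _ m] exI[of _ "m * (2 * w)"] conjI) (rule refl h(4,5) | assumption | linarith)+
qed

text \<open>With \<open>i <= ie\<close> and \<open>j <= n\<close>, the equation
  \<open>k + ie = i + j\<close> leaves no slack once \<open>k\<close> has reached \<open>n\<close>:
  both runs are exhausted and no further pair exists.\<close>

lemma merging_done:
  assumes "merging key n w X i ie j je k Y" "n \<le> k"
  shows "Y ` {..<n} = X ` {..<n}" "sorted_blocks key (2 * w) n Y"
proof -
  have h: "k = n" "i = ie" "j = n" "ie \<le> j" "Y ` {..<k} = X ` {..<i} \<union> X ` {ie..<j}"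
    "sorted_blocks key (2 * w) k Y"
    using assms unfolding merging_def by auto
  have "{..<n} = {..<ie} \<union> {ie..<n}" using h by auto
  then show "Y ` {..<n} = X ` {..<n}" using h by (metis image_Un)
  show "sorted_blocks key (2 * w) n Y" using h by simp
qed

section \<open>Sorting on the real RAM\<close>

text \<open>
  Index registers 0, 1, 3 and 4 hold the number of points, the constants 1 and 0, and the answer;
  real registers 2 and 3 hold the sentinel (a number below every \<open>y\<close> and \<open>-y\<close>) and 0.
  Both halves of the index memory \<open>[0, 2n)\<close> serve in turn as source and target of a merging pass;
  registers 10 to 12 hold the run length and the base addresses of the source and the target.
\<close>

definition base_state :: "nat \<Rightarrow> real \<Rightarrow> (nat \<Rightarrow> real) \<Rightarrow> (nat \<Rightarrow> nat) \<Rightarrow> ram_state \<Rightarrow> bool" where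
  "base_state n M rm cm s \<longleftrightarrow> ireg s 0 = n \<and> ireg s 1 = 1 \<and> ireg s 3 = 0 \<and> ireg s 4 = 0 \<and>
     rreg s 2 = M \<and> rreg s 3 = 0 \<and> creg s = (\<lambda>_. 0) \<and> rmem s = rm \<and> cmem s = cm"

definition init_step :: com where
  "init_step = ops [IStore 20 20, IAdd 5 20 20, IAdd 5 5 1, RLoad 0 5, RMul 0 0 0, RSub 2 2 0, IAdd 20 20 1]"

definition init :: com where
  "init = ops [IConst 1 1, RConst 2 (- 1)] ;; While (ILess 20 0) init_step"

text \<open>Because \<open>|y| < 1 + y * y\<close>, this lies below every \<open>y\<close> and
  \<open>-y\<close>, and it is accumulated by arithmetic alone, without comparing reals.
  \<open>Suc (u + u)\<close> is the address of the ordinate of point \<open>u\<close>.\<close>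

definition sentinel :: "nat \<Rightarrow> (nat \<Rightarrow> real) \<Rightarrow> real" where
  "sentinel n rm = - 1 - (\<Sum>u<n. rm (Suc (u + u)) * rm (Suc (u + u)))"

lemma ensures_init:
  assumes s: "ireg s = (\<lambda>j. if j = 0 then n else 0)" "rreg s = (\<lambda>_. 0)" "creg s = (\<lambda>_. 0)"
    "rmem s = rm" "cmem s = cm"
  shows "ensures init (2 + (n * (cost init_step + 2) + 2)) s
    (\<lambda>s. base_state n (sentinel n rm) rm cm s \<and> (\<forall>u<n. imem s u = u))"
proof -
  define I where "I k s \<longleftrightarrow> base_state n (sentinel (n - k) rm) rm cm s \<and> k \<le> n \<and> ireg s 20 = n - k \<and>
    (\<forall>u<n - k. imem s u = u)" for k s
  show ?thesis
    unfolding init_def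
  proof (rule ensures_Seq)
    show "ensures (ops [IConst 1 1, RConst 2 (- 1)]) 2 s (I n)"
      by (rule ensures_mono[OF ensures_loop_free[where Q = "I n"]])
        (use s in \<open>simp_all add: I_def base_state_def sentinel_def\<close>)
  next
    fix s assume "I n s"
    then show "ensures (While (ILess 20 0) init_step) (n * (cost init_step + 2) + 2) s
      (\<lambda>s. base_state n (sentinel n rm) rm cm s \<and> (\<forall>u<n. imem s u = u))"
    proof (rule ensures_While[where I = I])
      fix k s assume I: "I k s" and "holds (ILess 20 0) s"
      then have k: "0 < k" "k \<le> n" and "n - (k - 1) = Suc (n - k)" by (auto simp: I_def base_state_def)
      then have "I (k - 1) (ev init_step s)"
        using I by (simp add: I_def base_state_def init_step_def sentinel_def less_Suc_eq)
      then have "\<exists>k'<k. I k' (ev init_step s)"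
        using k by (intro exI[of _ "k - 1"]) simp
      then show "ensures init_step (cost init_step) s (\<lambda>s'. \<exists>k'<k. I k' s')"
        by (intro ensures_loop_free) (simp_all add: init_step_def)
    next
      fix k s assume I: "I k s" and "\<not> holds (ILess 20 0) s"
      then have "n - k = n" by (auto simp: I_def base_state_def)
      with I show "base_state n (sentinel n rm) rm cm s \<and> (\<forall>u<n. imem s u = u)"
        by (auto simp: I_def base_state_def)
    qed
  qed
qed

section \<open>One merging pass\<close>

definition next_runs :: com where
  "next_runs =
     ops [IMove 13 16, IAdd 14 13 10] ;; Cond (ILess 0 14) (Op (IMove 14 0)) Skip ;;
     ops [IMove 15 14, IAdd 16 15 10] ;; Cond (ILess 0 16) (Op (IMove 16 0)) Skip"

lemma ev_next_runs:
  "ev next_runs s = (let ie = min (ireg s 16 + ireg s 10) (ireg s 0) in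
     s\<lparr>ireg := (ireg s)(13 := ireg s 16, 14 := ie, 15 := ie, 16 := min (ie + ireg s 10) (ireg s 0))\<rparr>)"
  by (simp add: next_runs_def Let_def min_def fun_eq_iff)

definition pick_left :: com where "pick_left = ops [IStore 5 8, IAdd 13 13 1]"
definition pick_right :: com where "pick_right = ops [IStore 5 9, IAdd 15 15 1]"

text \<open>Both keys are loaded before the tests for exhausted runs. Reading past a run is
  harmless, since memory is total and that value is then ignored.\<close>

definition pick :: com where
  "pick = ops [IAdd 5 11 13, ILoad 8 5, IAdd 5 11 15, ILoad 9 5,
      IAdd 5 8 8, RLoad 0 5, IAdd 5 9 9, RLoad 1 5, IAdd 5 12 17] ;;
    Cond (ILess 13 14) (Cond (IEq 15 16) pick_left (Cond (RLess 1 0) pick_right pick_left)) pick_right ;;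
    Op (IAdd 17 17 1)"

text \<open>Changing to the next pair of runs is folded into the step that writes the next element.
  Each round of the loop thus writes exactly one, and a pass takes linear time.\<close>

definition merge_step :: com where
  "merge_step = Cond (IEq 13 14) (Cond (IEq 15 16) next_runs Skip) Skip ;; pick"

abbreviation x_key :: "(nat \<Rightarrow> real) \<Rightarrow> nat \<Rightarrow> real" where
  "x_key rm p \<equiv> rm (p + p)"

definition merge_inv ::
  "nat \<Rightarrow> real \<Rightarrow> (nat \<Rightarrow> real) \<Rightarrow> (nat \<Rightarrow> nat) \<Rightarrow> nat \<Rightarrow> nat \<Rightarrow> nat \<Rightarrow> (nat \<Rightarrow> nat) \<Rightarrow> ram_state \<Rightarrow> bool" where
  "merge_inv n M rm cm w a b X s \<longleftrightarrow> base_state n M rm cm s \<and>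
     ireg s 10 = w \<and> ireg s 11 = a \<and> ireg s 12 = b \<and> (\<forall>u<n. imem s (a + u) = X u) \<and>
     merging (x_key rm) n w X (ireg s 13) (ireg s 14) (ireg s 15) (ireg s 16) (ireg s 17)
       (\<lambda>u. imem s (b + u))"

lemma merging_bounds:
  assumes "merging key n w X i ie j je k Y"
  shows "i \<le> ie" "ie \<le> j" "j \<le> je" "je \<le> n" "k \<le> n" "k + ie = i + j"
  using assms unfolding merging_def by auto

lemma merge_inv_pick:
  assumes inv: "merge_inv n M rm cm w a b X s" and k: "ireg s 17 < n"
    and ne: "ireg s 13 < ireg s 14 \<or> ireg s 15 < ireg s 16"
    and ab: "a = 0 \<and> b = n \<or> a = n \<and> b = 0" and w: "0 < w"
    and X: "sorted_blocks (x_key rm) w n X"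
  shows "merge_inv n M rm cm w a b X (ev pick s) \<and> ireg (ev pick s) 17 = Suc (ireg s 17)"
proof -
  define i ie j je k where r: "i = ireg s 13" "ie = ireg s 14" "j = ireg s 15" "je = ireg s 16" "k = ireg s 17"
  define Y where "Y = (\<lambda>u. imem s (b + u))"
  have m: "merging (x_key rm) n w X i ie j je k Y"
    using inv by (simp add: merge_inv_def r Y_def)
  note bounds = merging_bounds[OF m]
  have k: "k < n" using k r by simp
  \<comment> \<open>Source and target are disjoint halves of the index memory, so the write leaves
    the source intact.\<close>
  have disj: "a + u \<noteq> b + k" if "u < n" for u using ab k that by auto
  show ?thesis
  proof (cases "i < ie \<and> (j = je \<or> x_key rm (X i) \<le> x_key rm (X j))")
    case True
    have "merging (x_key rm) n w X (Suc i) ie j je (Suc k) (Y(k := X i))"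
      by (rule merging_left[OF m X w]) (use True in auto)
    then have m': "merging (x_key rm) n w X (Suc i) ie j je (Suc k) (\<lambda>u. if u = k then X i else imem s (b + u))"
      by (simp add: fun_upd_def Y_def)
    have regs: "ireg s 13 = i" "ireg s 14 = ie" "ireg s 15 = j" "ireg s 16 = je" "ireg s 17 = k"
      using r by simp_all
    have xi: "imem s (a + i) = X i" using inv True bounds by (simp add: merge_inv_def)
    have xj: "imem s (a + j) = X j" if "j \<noteq> je" using inv bounds that by (simp add: merge_inv_def)
    have c: "j = je \<or> \<not> x_key rm (X j) < x_key rm (X i)" using True by auto
    show ?thesis
      using True inv m' disj xi xj c regs
      by (cases "j = je") (simp_all add: pick_def pick_left_def merge_inv_def base_state_def)
  next
    case False
    have j: "j < je" using False ne bounds r by auto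
    have "merging (x_key rm) n w X i ie (Suc j) je (Suc k) (Y(k := X j))"
      by (rule merging_right[OF m X w j]) (use False j in auto)
    then have m': "merging (x_key rm) n w X i ie (Suc j) je (Suc k) (\<lambda>u. if u = k then X j else imem s (b + u))"
      by (simp add: fun_upd_def Y_def)
    have regs: "ireg s 13 = i" "ireg s 14 = ie" "ireg s 15 = j" "ireg s 16 = je" "ireg s 17 = k"
      using r by simp_all
    have xi: "imem s (a + i) = X i" if "i < ie" using inv bounds that by (simp add: merge_inv_def)
    have xj: "imem s (a + j) = X j" using inv bounds j by (simp add: merge_inv_def)
    have c: "j \<noteq> je" "i < ie \<Longrightarrow> x_key rm (X j) < x_key rm (X i)" using False j by auto
    show ?thesis
      using inv m' disj xi xj c regs
      by (cases "i < ie") (simp_all add: pick_def pick_right_def merge_inv_def base_state_def)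
  qed
qed

lemma merge_inv_step:
  assumes inv: "merge_inv n M rm cm w a b X s" and k: "ireg s 17 < n"
    and ab: "a = 0 \<and> b = n \<or> a = n \<and> b = 0" and w: "0 < w"
    and X: "sorted_blocks (x_key rm) w n X"
  shows "merge_inv n M rm cm w a b X (ev merge_step s) \<and> ireg (ev merge_step s) 17 = Suc (ireg s 17)"
proof (cases "ireg s 13 = ireg s 14 \<and> ireg s 15 = ireg s 16")
  case True
  let ?s = "ev next_runs s"
  have m: "merging (x_key rm) n w X (ireg s 13) (ireg s 14) (ireg s 15) (ireg s 16) (ireg s 17) (\<lambda>u. imem s (b + u))"
    using inv by (simp add: merge_inv_def)
  note bounds = merging_bounds[OF m]
  have "merge_inv n M rm cm w a b X ?s"
    using inv merging_next[OF m[unfolded conjunct1[OF True] conjunct2[OF True]] k] True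
    by (simp add: merge_inv_def base_state_def ev_next_runs Let_def)
  moreover have "ireg ?s 17 = ireg s 17" by (simp add: ev_next_runs Let_def)
  \<comment> \<open>With both runs exhausted, the number of written values equals the right read
    position; being below \<open>n\<close>, it starts a nonempty run.\<close>
  moreover have "ireg ?s 13 < ireg ?s 14"
    using inv w k bounds True by (simp add: merge_inv_def base_state_def ev_next_runs Let_def)
  ultimately have "merge_inv n M rm cm w a b X (ev pick ?s) \<and> ireg (ev pick ?s) 17 = Suc (ireg s 17)"
    using merge_inv_pick[of n M rm cm w a b X ?s] k ab w X by simp
  then show ?thesis using True by (simp add: merge_step_def)
next
  case False
  then have "ireg s 13 < ireg s 14 \<or> ireg s 15 < ireg s 16"
    using merging_bounds(1,3)[of "x_key rm" n w X "ireg s 13" "ireg s 14" "ireg s 15" "ireg s 16" "ireg s 17" "\<lambda>u. imem s (b + u)"] inv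
    unfolding merge_inv_def by linarith
  from merge_inv_pick[OF inv k this ab w X] False show ?thesis
    by (auto simp: merge_step_def)
qed

definition start_pass :: com where "start_pass = ops [IConst 17 0, IConst 16 0] ;; next_runs"
definition finish_pass :: com where
  "finish_pass = ops [IMove 5 11, IMove 11 12, IMove 12 5, IAdd 10 10 10]"
definition pass :: com where
  "pass = start_pass ;; While (ILess 17 0) merge_step ;; finish_pass"

text \<open>\<open>t\<close> bounds the passes left: doubling the run length turns
  \<open>n <= w * 2 ^ Suc t\<close> into the same bound with \<open>t\<close>.\<close>

definition sort_inv ::
  "nat \<Rightarrow> real \<Rightarrow> (nat \<Rightarrow> real) \<Rightarrow> (nat \<Rightarrow> nat) \<Rightarrow> nat \<Rightarrow> ram_state \<Rightarrow> bool" where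
  "sort_inv n M rm cm t s \<longleftrightarrow> base_state n M rm cm s \<and> 0 < ireg s 10 \<and>
     (ireg s 11 = 0 \<and> ireg s 12 = n \<or> ireg s 11 = n \<and> ireg s 12 = 0) \<and>
     (\<lambda>u. imem s (ireg s 11 + u)) ` {..<n} = {..<n} \<and>
     sorted_blocks (x_key rm) (ireg s 10) n (\<lambda>u. imem s (ireg s 11 + u)) \<and>
     n \<le> ireg s 10 * 2 ^ t"

definition pass_time :: "nat \<Rightarrow> nat" where
  "pass_time n = cost start_pass + ((n * (cost merge_step + 2) + 2) + cost finish_pass)"

lemma ensures_pass:
  assumes inv: "sort_inv n M rm cm (Suc t) s"
  shows "ensures pass (pass_time n) s (sort_inv n M rm cm t)"
proof -
  define w a b X where d: "w = ireg s 10" "a = ireg s 11" "b = ireg s 12" "X = (\<lambda>u. imem s (a + u))"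
  have h: "base_state n M rm cm s" "0 < w" "a = 0 \<and> b = n \<or> a = n \<and> b = 0" "X ` {..<n} = {..<n}"
    "sorted_blocks (x_key rm) w n X" "n \<le> w * 2 ^ Suc t"
    using inv unfolding sort_inv_def d by simp_all
  define I where "I k s \<longleftrightarrow> merge_inv n M rm cm w a b X s \<and> k = n - ireg s 17" for k s
  show ?thesis
    unfolding pass_def pass_time_def
  proof (intro ensures_Seq)
    have "I n (ev start_pass s)"
      using h(1) merging_start[of "x_key rm" n w X]
      by (simp add: start_pass_def ev_next_runs Let_def I_def merge_inv_def base_state_def d)
    then show "ensures start_pass (cost start_pass) s (I n)"
      by (intro ensures_loop_free) (simp_all add: start_pass_def next_runs_def)
  next
    fix s assume "I n s"
    then show "ensures (While (ILess 17 0) merge_step) (n * (cost merge_step + 2) + 2) s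
        (\<lambda>s. merge_inv n M rm cm w a b X s \<and> n \<le> ireg s 17)"
    proof (rule ensures_While[where I = I])
      fix k s assume I: "I k s" and g: "holds (ILess 17 0) s"
      then have k: "ireg s 17 < n" "k = n - ireg s 17" by (auto simp: I_def merge_inv_def base_state_def)
      then have "I (n - Suc (ireg s 17)) (ev merge_step s)"
        using merge_inv_step[OF _ k(1) h(3,2,5)] I by (simp add: I_def)
      then have "\<exists>k'<k. I k' (ev merge_step s)"
        using k by (intro exI[of _ "n - Suc (ireg s 17)"]) simp
      then show "ensures merge_step (cost merge_step) s (\<lambda>s'. \<exists>k'<k. I k' s')"
        by (intro ensures_loop_free)
          (simp_all add: merge_step_def next_runs_def pick_def pick_left_def pick_right_def)
    next
      fix k s assume "I k s" and "\<not> holds (ILess 17 0) s"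
      then show "merge_inv n M rm cm w a b X s \<and> n \<le> ireg s 17"
        by (auto simp: I_def merge_inv_def base_state_def)
    qed
  next
    fix s assume s: "merge_inv n M rm cm w a b X s \<and> n \<le> ireg s 17"
    then have "merging (x_key rm) n w X (ireg s 13) (ireg s 14) (ireg s 15) (ireg s 16) (ireg s 17)
        (\<lambda>u. imem s (b + u))"
      by (simp add: merge_inv_def)
    from merging_done[OF this conjunct2[OF s]]
    moreover have "b = 0 \<and> a = n \<or> b = n \<and> a = 0" using h(3) by blast
    ultimately have "sort_inv n M rm cm t (ev finish_pass s)"
      using s h by (simp add: sort_inv_def finish_pass_def merge_inv_def base_state_def mult_2 add_mult_distrib add_mult_distrib2)
    then show "ensures finish_pass (cost finish_pass) s (sort_inv n M rm cm t)"
      by (intro ensures_loop_free) (simp_all add: finish_pass_def)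
  qed
qed

section \<open>Merge sort by repeated passes\<close>

definition sort_init :: com where "sort_init = ops [IConst 10 1, IConst 11 0, IMove 12 0]"
definition sort_by_x :: com where
  "sort_by_x = sort_init ;; While (ILess 10 0) pass"

definition sorted_state :: "nat \<Rightarrow> real \<Rightarrow> (nat \<Rightarrow> real) \<Rightarrow> (nat \<Rightarrow> nat) \<Rightarrow> ram_state \<Rightarrow> bool" where
  "sorted_state n M rm cm s \<longleftrightarrow> base_state n M rm cm s \<and>
     (\<lambda>u. imem s (ireg s 11 + u)) ` {..<n} = {..<n} \<and>
     (\<forall>u v. u \<le> v \<longrightarrow> v < n \<longrightarrow>
        x_key rm (imem s (ireg s 11 + u)) \<le> x_key rm (imem s (ireg s 11 + v)))"

lemma ensures_sort_by_x:
  assumes s: "base_state n M rm cm s" "\<forall>u<n. imem s u = u" and t: "n \<le> 2 ^ t"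
  shows "ensures sort_by_x (cost sort_init + (t * (pass_time n + 2) + 2)) s (sorted_state n M rm cm)"
  unfolding sort_by_x_def
proof (rule ensures_Seq)
  have "(\<lambda>u. imem s u) ` {..<n} = {..<n}" using s(2) by force
  then have "sort_inv n M rm cm t (ev sort_init s)"
    using s t by (simp add: sort_init_def sort_inv_def base_state_def sorted_blocks_def)
  then show "ensures sort_init (cost sort_init) s (sort_inv n M rm cm t)"
    by (intro ensures_loop_free) (simp_all add: sort_init_def)
next
  fix s assume "sort_inv n M rm cm t s"
  then show "ensures (While (ILess 10 0) pass) (t * (pass_time n + 2) + 2) s (sorted_state n M rm cm)"
  proof (rule ensures_While)
    fix k s assume inv: "sort_inv n M rm cm k s" and "holds (ILess 10 0) s"
    \<comment> \<open>For \<open>k = 0\<close> the invariant says that the run length is at least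
      \<open>n\<close>, against the guard.\<close>
    then have "k \<noteq> 0" by (cases k) (auto simp: sort_inv_def base_state_def)
    then obtain k' where k': "k = Suc k'" using not0_implies_Suc by blast
    show "ensures pass (pass_time n) s (\<lambda>s'. \<exists>k'<k. sort_inv n M rm cm k' s')"
      by (rule ensures_mono[OF ensures_pass[OF inv[unfolded k']]]) (use k' in auto)
  next
    fix k s assume inv: "sort_inv n M rm cm k s" and g: "\<not> holds (ILess 10 0) s"
    then have w: "n \<le> ireg s 10" by (auto simp: sort_inv_def base_state_def)
    \<comment> \<open>With runs of length at least \<open>n\<close>, all positions lie in block
      0.\<close>
    have "x_key rm (imem s (ireg s 11 + u)) \<le> x_key rm (imem s (ireg s 11 + v))"
      if "u \<le> v" "v < n" for u v
      using inv w that unfolding sort_inv_def sorted_blocks_def by (cases "u = v") auto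
    with inv show "sorted_state n M rm cm s" by (simp add: sorted_state_def sort_inv_def)
  qed
qed

section \<open>Scanning\<close>

text \<open>
  The real and color registers 16 to 31 are four groups of four slots: the highest and the lowest
  points seen from the left, then those seen from the right. Unused slots hold the sentinel.
  The carried entry is in registers 0, and registers 1 are scratch.
\<close>

definition slot :: "ram_state \<Rightarrow> nat \<Rightarrow> real \<times> nat" where
  "slot s r = (rreg s r, creg s r)"

definition same_mem :: "ram_state \<Rightarrow> ram_state \<Rightarrow> bool" where
  "same_mem s s' \<longleftrightarrow> imem s' = imem s \<and> rmem s' = rmem s \<and> cmem s' = cmem s"

section \<open>Inserting an entry into a group of registers\<close>

definition swap_max :: "nat \<Rightarrow> com" where
  "swap_max r = Cond (RLess r 0)
     (ops [RMove 1 r, CMove 1 r, RMove r 0, CMove r 0, RMove 0 1, CMove 0 1]) Skip"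

lemma ev_swap_max:
  fixes s :: ram_state
  assumes "1 < r"
  defines "s' \<equiv> ev (swap_max r) s"
  shows "slot s' r = (if fst (slot s r) < fst (slot s 0) then slot s 0 else slot s r)"
    "slot s' 0 = (if fst (slot s r) < fst (slot s 0) then slot s r else slot s 0)"
    "\<And>q. 1 < q \<Longrightarrow> q \<noteq> r \<Longrightarrow> slot s' q = slot s q"
    "same_mem s s'" "ireg s' = ireg s"
  using assms(1) by (simp_all add: s'_def swap_max_def slot_def same_mem_def)

lemma ev_bubble:
  fixes s :: ram_state
  assumes "distinct rs" "\<forall>r\<in>set rs. 1 < r"
  defines "s' \<equiv> ev (seqs (map swap_max rs)) s"
  shows "map (slot s') rs = bubble (slot s 0) (map (slot s) rs) \<and>
    (\<forall>q. 1 < q \<longrightarrow> q \<notin> set rs \<longrightarrow> slot s' q = slot s q) \<and> same_mem s s' \<and> ireg s' = ireg s"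
  using assms(1,2) unfolding s'_def
proof (induction rs arbitrary: s)
  case (Cons r rs)
  let ?s = "ev (swap_max r) s"
  have r: "1 < r" using Cons.prems by simp
  have m: "map (slot ?s) rs = map (slot s) rs"
    using Cons.prems by (auto intro!: ev_swap_max(3))
  show ?case
    using Cons.IH[of ?s, unfolded m] Cons.prems ev_swap_max[OF r, where s = s] by (auto simp: same_mem_def)
qed (simp add: same_mem_def)

text \<open>Index register 7 reports that an occupied slot has the color of the carried entry. The
  colors agree in that case, so only the height has to be copied.\<close>

definition raise :: "nat \<Rightarrow> com" where
  "raise r = Cond (CEq r 0)
     (Cond (RLess 2 r) (Op (IConst 7 1) ;; Cond (RLess r 0) (Op (RMove r 0)) Skip) Skip) Skip"

definition agree :: "real \<Rightarrow> real \<times> nat \<Rightarrow> real \<times> nat \<Rightarrow> bool" where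
  "agree M p l \<longleftrightarrow> snd l = snd p \<and> M < fst l"

lemma ev_raise:
  fixes s :: ram_state
  assumes "2 < r"
  defines "s' \<equiv> ev (raise r) s"
  shows "slot s' r = (if agree (rreg s 2) (slot s 0) (slot s r) \<and> fst (slot s r) < fst (slot s 0)
      then slot s 0 else slot s r)"
    "\<And>q. q \<noteq> r \<Longrightarrow> slot s' q = slot s q" "rreg s' 2 = rreg s 2"
    "same_mem s s'" "\<And>q. q \<noteq> 7 \<Longrightarrow> ireg s' q = ireg s q"
    "ireg s' 7 = (if agree (rreg s 2) (slot s 0) (slot s r) then 1 else ireg s 7)"
  using assms(1) by (auto simp: s'_def raise_def slot_def same_mem_def agree_def)

lemma ev_raises:
  fixes s :: ram_state
  assumes "distinct rs" "\<forall>r\<in>set rs. 2 < r"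
  defines "s' \<equiv> ev (seqs (map raise rs)) s" and "ag \<equiv> agree (rreg s 2) (slot s 0)"
  shows "map (slot s') rs =
      map (\<lambda>l. if ag l \<and> fst l < fst (slot s 0) then slot s 0 else l) (map (slot s) rs) \<and>
    (\<forall>q. q \<notin> set rs \<longrightarrow> slot s' q = slot s q) \<and> same_mem s s' \<and> (\<forall>q. q \<noteq> 7 \<longrightarrow> ireg s' q = ireg s q) \<and>
    ireg s' 7 = (if \<exists>l\<in>set (map (slot s) rs). ag l then 1 else ireg s 7)"
  using assms(1,2) unfolding s'_def ag_def
proof (induction rs arbitrary: s)
  case (Cons r rs)
  let ?s = "ev (raise r) s"
  have r: "2 < r" using Cons.prems by simp
  have m: "map (slot ?s) rs = map (slot s) rs"
    using Cons.prems r by (auto intro!: ev_raise(2))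
  have "slot ?s 0 = slot s 0" using ev_raise(2)[OF r, of 0] r by simp
  then show ?case
    using Cons.IH[of ?s, unfolded m] Cons.prems ev_raise[OF r, where s = s] by (auto simp: same_mem_def)
qed (simp add: same_mem_def)

text \<open>One sweep performs both the color test and the raising branch of
  \<open>insert_champion\<close>. If it leaves register 7 at 0, no slot has changed, and bubbling
  starts from the original entries.\<close>

definition insert_code :: "nat list \<Rightarrow> com" where
  "insert_code rs = Op (IConst 7 0) ;; seqs (map raise rs) ;; Cond (IEq 7 3) (seqs (map swap_max rs)) Skip"

lemma ev_insert_code:
  fixes s :: ram_state
  assumes rs: "distinct rs" "\<forall>r\<in>set rs. 2 < r" and z: "ireg s 3 = 0"
  defines "s' \<equiv> ev (insert_code rs) s"
  shows "map (slot s') rs = insert_champion (rreg s 2) (slot s 0) (map (slot s) rs)"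
    "\<And>q. 1 < q \<Longrightarrow> q \<notin> set rs \<Longrightarrow> slot s' q = slot s q"
    "same_mem s s'" "\<And>q. q \<noteq> 7 \<Longrightarrow> ireg s' q = ireg s q"
proof -
  define s0 s1 where "s0 = ev (Op (IConst 7 0)) s" and "s1 = ev (seqs (map raise rs)) s0"
  have rs1: "\<forall>r\<in>set rs. 1 < r" using rs by auto
  have z0: "0 \<notin> set rs" using rs by auto
  have s0: "slot s0 = slot s" "rreg s0 = rreg s" "same_mem s s0" "\<And>q. q \<noteq> 7 \<Longrightarrow> ireg s0 q = ireg s q" "ireg s0 7 = 0"
    by (auto simp: s0_def slot_def same_mem_def)
  note r = ev_raises[OF rs, of s0, folded s1_def, unfolded s0(1,2)]
  note b = ev_bubble[OF rs(1) rs1, of s1]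
  have s': "s' = (if ireg s1 7 = 0 then ev (seqs (map swap_max rs)) s1 else s1)"
    using r z s0 unfolding s'_def insert_code_def by (simp add: s1_def s0_def)
  let ?f = "\<exists>l\<in>set (map (slot s) rs). agree (rreg s 2) (slot s 0) l"
  have A: "map (slot s') rs = insert_champion (rreg s 2) (slot s 0) (map (slot s) rs) \<and>
    (\<forall>q. 1 < q \<longrightarrow> q \<notin> set rs \<longrightarrow> slot s' q = slot s q) \<and> same_mem s s' \<and> (\<forall>q. q \<noteq> 7 \<longrightarrow> ireg s' q = ireg s q)"
  proof (cases ?f)
    case True
    then have "ireg s1 7 = 1" using r by auto
    then have "s' = s1" using s' by simp
    then show ?thesis
      using True r s0 by (simp add: insert_champion_def agree_def same_mem_def conj_ac)
  next
    case False
    then have "ireg s1 7 = 0" using r s0 by auto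
    then have e: "s' = ev (seqs (map swap_max rs)) s1" using s' by simp
    have "map (slot s1) rs = map (slot s) rs" using r False by auto
    moreover have "slot s1 0 = slot s 0" using r z0 by blast
    ultimately have mb: "map (slot s') rs = bubble (slot s 0) (map (slot s) rs)"
      using b unfolding e by metis
    have ins: "insert_champion (rreg s 2) (slot s 0) (map (slot s) rs) = bubble (slot s 0) (map (slot s) rs)"
      using False by (auto simp: insert_champion_def agree_def)
    show ?thesis
      unfolding mb ins using r b s0 unfolding e by (auto simp: same_mem_def)
  qed
  then show "map (slot s') rs = insert_champion (rreg s 2) (slot s 0) (map (slot s) rs)"
    "\<And>q. 1 < q \<Longrightarrow> q \<notin> set rs \<Longrightarrow> slot s' q = slot s q"
    "same_mem s s'" "\<And>q. q \<noteq> 7 \<Longrightarrow> ireg s' q = ireg s q"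
    by blast+
qed

definition feed :: "nat \<Rightarrow> bool \<Rightarrow> nat list \<Rightarrow> com" where
  "feed p neg rs = ops [IAdd 5 p p, IAdd 5 5 1, RLoad 0 5, CLoad 0 p] ;;
     (if neg then Op (RSub 0 3 0) else Skip) ;; insert_code rs"

definition entry :: "(nat \<Rightarrow> real) \<Rightarrow> (nat \<Rightarrow> nat) \<Rightarrow> bool \<Rightarrow> nat \<Rightarrow> real \<times> nat" where
  "entry rm cm neg p = (if neg then - rm (Suc (p + p)) else rm (Suc (p + p)), cm p)"

lemma ev_feed:
  fixes s :: ram_state and neg :: bool
  assumes rs: "distinct rs" "\<forall>r\<in>set rs. 2 < r" and z: "ireg s 3 = 0" "ireg s 1 = 1" "rreg s 3 = 0"
    and p: "p \<noteq> 5"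
  defines "s' \<equiv> ev (feed p neg rs) s"
  shows "map (slot s') rs =
      insert_champion (rreg s 2) (entry (rmem s) (cmem s) neg (ireg s p)) (map (slot s) rs)"
    "\<And>q. 1 < q \<Longrightarrow> q \<notin> set rs \<Longrightarrow> slot s' q = slot s q"
    "same_mem s s'" "\<And>q. q \<noteq> 5 \<Longrightarrow> q \<noteq> 7 \<Longrightarrow> ireg s' q = ireg s q"
proof -
  define s0 where "s0 = ev (ops [IAdd 5 p p, IAdd 5 5 1, RLoad 0 5, CLoad 0 p] ;;
     (if neg then Op (RSub 0 3 0) else Skip)) s"
  have e: "s' = ev (insert_code rs) s0" by (simp add: s'_def s0_def feed_def)
  have s0: "slot s0 0 = entry (rmem s) (cmem s) neg (ireg s p)" "\<And>q. 0 < q \<Longrightarrow> slot s0 q = slot s q"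
    "same_mem s s0" "\<And>q. q \<noteq> 5 \<Longrightarrow> ireg s0 q = ireg s q" "rreg s0 2 = rreg s 2" "ireg s0 3 = 0"
    using z p by (auto simp: s0_def slot_def same_mem_def entry_def)
  have "map (slot s0) rs = map (slot s) rs" using rs by (auto intro!: s0(2))
  note i = ev_insert_code[OF rs s0(6), folded e, unfolded this s0(1,5)]
  show "map (slot s') rs =
      insert_champion (rreg s 2) (entry (rmem s) (cmem s) neg (ireg s p)) (map (slot s) rs)"
    by (rule i(1))
  show "\<And>q. 1 < q \<Longrightarrow> q \<notin> set rs \<Longrightarrow> slot s' q = slot s q" using i(2) s0(2) by simp
  show "same_mem s s'" using i(3) s0(3) by (simp add: same_mem_def)
  show "\<And>q. q \<noteq> 5 \<Longrightarrow> q \<noteq> 7 \<Longrightarrow> ireg s' q = ireg s q" using i(4) s0(4) by simp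
qed

section \<open>Recording the champions in memory\<close>

definition cells :: "ram_state \<Rightarrow> nat \<Rightarrow> nat \<Rightarrow> (real \<times> nat) list" where
  "cells s b k = map (\<lambda>i. (rmem s (b + i), cmem s (b + i))) [0..<k]"

lemma cells_Suc: "cells s a (Suc k) = (rmem s a, cmem s a) # cells s (Suc a) k"
  unfolding cells_def upt_conv_Cons[OF zero_less_Suc] map_Suc_upt[symmetric] by simp

lemma length_cells [simp]: "length (cells s b k) = k"
  by (simp add: cells_def)

definition store :: "nat \<Rightarrow> com" where
  "store r = ops [RStore 22 r, CStore 22 r, IAdd 22 22 1]"

lemma ev_stores:
  fixes s :: ram_state and rs :: "nat list"
  assumes "ireg s 1 = 1"
  defines "s' \<equiv> ev (seqs (map store rs)) s"
  shows "rreg s' = rreg s \<and> creg s' = creg s \<and> imem s' = imem s \<and>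
    ireg s' = (ireg s)(22 := ireg s 22 + length rs) \<and>
    cells s' (ireg s 22) (length rs) = map (slot s) rs \<and>
    (\<forall>i. i < ireg s 22 \<or> ireg s 22 + length rs \<le> i \<longrightarrow> rmem s' i = rmem s i \<and> cmem s' i = cmem s i)"
  using assms(1) unfolding s'_def
proof (induction rs arbitrary: s)
  case (Cons r rs)
  let ?s = "ev (store r) s"
  have h: "rreg ?s = rreg s" "creg ?s = creg s" "imem ?s = imem s" "ireg ?s = (ireg s)(22 := Suc (ireg s 22))"
    "rmem ?s = (rmem s)(ireg s 22 := rreg s r)" "cmem ?s = (cmem s)(ireg s 22 := creg s r)"
    using Cons.prems by (simp_all add: store_def)
  note ih = Cons.IH[of ?s, unfolded h]
  have sl: "slot ?s = slot s" using h by (simp add: slot_def fun_eq_iff)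
  show ?case
    using ih Cons.prems unfolding sl by (auto simp: cells_Suc slot_def)
qed (simp add: cells_def)

text \<open>A single loop scans from both ends: round \<open>t\<close>, counted from 0, reads the
  sorted positions \<open>t\<close> and \<open>n - Suc t\<close>. Its record of 16 entries therefore
  belongs to the prefix and to the suffix of length \<open>t + 1\<close>.\<close>

definition scan_step :: com where
  "scan_step = ops [IAdd 5 11 20, ILoad 8 5, ISub 21 21 1, IAdd 5 11 21, ILoad 9 5] ;;
    feed 8 False [16..<20] ;; feed 8 True [20..<24] ;; feed 9 False [24..<28] ;; feed 9 True [28..<32] ;;
    seqs (map store [16..<32]) ;; Op (IAdd 20 20 1)"

definition best :: "real \<Rightarrow> (nat \<Rightarrow> real \<times> nat) \<Rightarrow> nat \<Rightarrow> (real \<times> nat) list" where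
  "best M f t = fold (insert_champion M) (map f [0..<t]) (replicate 4 (M, 0))"

lemma best_Suc: "best M f (Suc t) = insert_champion M (f t) (best M f t)"
  by (simp add: best_def)

definition record_at :: "nat \<Rightarrow> real \<Rightarrow> (nat \<Rightarrow> real) \<Rightarrow> (nat \<Rightarrow> nat) \<Rightarrow> (nat \<Rightarrow> nat) \<Rightarrow> nat \<Rightarrow> (real \<times> nat) list" where
  "record_at n M rm cm A t =
     best M (\<lambda>u. entry rm cm False (A u)) t @ best M (\<lambda>u. entry rm cm True (A u)) t @
     best M (\<lambda>u. entry rm cm False (A (n - Suc u))) t @ best M (\<lambda>u. entry rm cm True (A (n - Suc u))) t"

text \<open>The records begin at \<open>2 * n\<close>, just above the coordinates. Color memory uses
  the same addresses, so one pointer serves both halves of an entry.\<close>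

definition scan_inv where
  "scan_inv n M rm cm A t s \<longleftrightarrow> t \<le> n \<and>
     ireg s 0 = n \<and> ireg s 1 = 1 \<and> ireg s 3 = 0 \<and> ireg s 4 = 0 \<and> rreg s 2 = M \<and> rreg s 3 = 0 \<and>
     (\<forall>u<n. imem s (ireg s 11 + u) = A u) \<and> ireg s 20 = t \<and> ireg s 21 = n - t \<and>
     ireg s 22 = 2 * n + 16 * t \<and> (\<forall>i<2 * n. rmem s i = rm i) \<and> (\<forall>i<n. cmem s i = cm i) \<and>
     map (slot s) [16..<20] = best M (\<lambda>u. entry rm cm False (A u)) t \<and>
     map (slot s) [20..<24] = best M (\<lambda>u. entry rm cm True (A u)) t \<and>
     map (slot s) [24..<28] = best M (\<lambda>u. entry rm cm False (A (n - Suc u))) t \<and>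
     map (slot s) [28..<32] = best M (\<lambda>u. entry rm cm True (A (n - Suc u))) t \<and>
     (\<forall>u<t. cells s (2 * n + 16 * u) 16 = record_at n M rm cm A (Suc u))"

lemma scan_inv_step:
  assumes inv: "scan_inv n M rm cm A t s" and t: "t < n" and A: "\<forall>u<n. A u < n"
  shows "scan_inv n M rm cm A (Suc t) (ev scan_step s)"
proof -
  define s0 where "s0 = ev (ops [IAdd 5 11 20, ILoad 8 5, ISub 21 21 1, IAdd 5 11 21, ILoad 9 5]) s"
  define s1 where "s1 = ev (feed 8 False [16..<20]) s0"
  define s2 where "s2 = ev (feed 8 True [20..<24]) s1"
  define s3 where "s3 = ev (feed 9 False [24..<28]) s2"
  define s4 where "s4 = ev (feed 9 True [28..<32]) s3"
  define s5 where "s5 = ev (seqs (map store [16..<32])) s4"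
  have s6: "ev scan_step s = ev (Op (IAdd 20 20 1)) s5"
    by (simp add: scan_step_def s5_def s4_def s3_def s2_def s1_def s0_def)
  have "\<forall>u<n. imem s (ireg s 11 + u) = A u" using inv by (simp add: scan_inv_def)
  \<comment> \<open>The right pointer is decremented before the load, hence \<open>n - Suc t\<close>
    and not \<open>n - t\<close>.\<close>
  from this[rule_format, of "n - Suc t"] t
  have "imem s (ireg s 11 + n - Suc t) = A (n - Suc t)" by simp
  then have i0: "ireg s0 8 = A t" "ireg s0 9 = A (n - Suc t)" "ireg s0 21 = n - Suc t"
    "\<And>q. q \<notin> {5, 8, 9, 21} \<Longrightarrow> ireg s0 q = ireg s q" "slot s0 = slot s" "same_mem s s0"
    using inv t by (auto simp: s0_def scan_inv_def slot_def same_mem_def)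
  have z0: "ireg s0 3 = 0" "ireg s0 1 = 1" "rreg s0 3 = 0" "rreg s0 2 = M"
    using inv i0(5) by (auto simp: i0(4) scan_inv_def slot_def fun_eq_iff)
  have gt: "\<forall>r\<in>set [16..<20]. (2::nat) < r" "\<forall>r\<in>set [20..<24]. (2::nat) < r"
    "\<forall>r\<in>set [24..<28]. (2::nat) < r" "\<forall>r\<in>set [28..<32]. (2::nat) < r"
    by simp_all
  have p: "8 \<noteq> (5::nat)" "9 \<noteq> (5::nat)" by simp_all
  note f1 = ev_feed[OF distinct_upt gt(1) z0(1-3) p(1), where neg = False, folded s1_def]
  have z1: "ireg s1 3 = 0" "ireg s1 1 = 1" "rreg s1 3 = 0" "rreg s1 2 = M"
    using z0 f1(2)[of 2] f1(2)[of 3] by (auto simp: f1(4) slot_def)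
  note f2 = ev_feed[OF distinct_upt gt(2) z1(1-3) p(1), where neg = True, folded s2_def]
  have z2: "ireg s2 3 = 0" "ireg s2 1 = 1" "rreg s2 3 = 0" "rreg s2 2 = M"
    using z1 f2(2)[of 2] f2(2)[of 3] by (auto simp: f2(4) slot_def)
  note f3 = ev_feed[OF distinct_upt gt(3) z2(1-3) p(2), where neg = False, folded s3_def]
  have z3: "ireg s3 3 = 0" "ireg s3 1 = 1" "rreg s3 3 = 0" "rreg s3 2 = M"
    using z2 f3(2)[of 2] f3(2)[of 3] by (auto simp: f3(4) slot_def)
  note f4 = ev_feed[OF distinct_upt gt(4) z3(1-3) p(2), where neg = True, folded s4_def]
  have z4: "ireg s4 3 = 0" "ireg s4 1 = 1" "rreg s4 3 = 0" "rreg s4 2 = M"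
    using z3 f4(2)[of 2] f4(2)[of 3] by (auto simp: f4(4) slot_def)
  have mem: "same_mem s s4"
    using i0(6) f1(3) f2(3) f3(3) f4(3) by (simp add: same_mem_def)
  have regs: "\<And>q. q \<notin> {5, 7, 8, 9, 21} \<Longrightarrow> ireg s4 q = ireg s q" "ireg s4 21 = n - Suc t"
    by (simp_all add: f1(4) f2(4) f3(4) f4(4) i0)
  have ip: "ireg s1 8 = A t" "ireg s2 9 = A (n - Suc t)" "ireg s3 9 = A (n - Suc t)"
    by (simp_all add: f1(4) f2(4) f3(4) i0)
  have ent: "entry (rmem s) (cmem s) neg (A u) = entry rm cm neg (A u)" if "u < n" for u neg
  proof -
    have "A u < n" using A that by blast
    then show ?thesis using inv by (simp add: entry_def scan_inv_def)
  qed
  have sm: "same_mem s s1" "same_mem s s2" "same_mem s s3"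
    using i0(6) f1(3) f2(3) f3(3) by (simp_all add: same_mem_def)
  have m0: "rmem s0 = rmem s" "cmem s0 = cmem s" "rmem s1 = rmem s" "cmem s1 = cmem s"
    "rmem s2 = rmem s" "cmem s2 = cmem s" "rmem s3 = rmem s" "cmem s3 = cmem s"
    using i0(6) sm by (simp_all add: same_mem_def)
  have slots:
    "map (slot s4) [16..<20] = best M (\<lambda>u. entry rm cm False (A u)) (Suc t)"
    "map (slot s4) [20..<24] = best M (\<lambda>u. entry rm cm True (A u)) (Suc t)"
    "map (slot s4) [24..<28] = best M (\<lambda>u. entry rm cm False (A (n - Suc u))) (Suc t)"
    "map (slot s4) [28..<32] = best M (\<lambda>u. entry rm cm True (A (n - Suc u))) (Suc t)"
  proof -
    have old: "map (slot s) [16..<20] = best M (\<lambda>u. entry rm cm False (A u)) t"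
      "map (slot s) [20..<24] = best M (\<lambda>u. entry rm cm True (A u)) t"
      "map (slot s) [24..<28] = best M (\<lambda>u. entry rm cm False (A (n - Suc u))) t"
      "map (slot s) [28..<32] = best M (\<lambda>u. entry rm cm True (A (n - Suc u))) t"
      using inv unfolding scan_inv_def by blast+
    have t': "n - Suc t < n" using t by simp
    \<comment> \<open>The four groups of registers are disjoint, so each is changed by its own
      \<open>feed\<close> alone.\<close>
    have "map (slot s4) [16..<20] = map (slot s1) [16..<20]"
      using f2(2) f3(2) f4(2) by simp
    then show "map (slot s4) [16..<20] = best M (\<lambda>u. entry rm cm False (A u)) (Suc t)"
      unfolding f1(1) i0(1,5) z0(4) m0 ent[OF t] best_Suc old .
    have a: "map (slot s4) [20..<24] = map (slot s2) [20..<24]" using f3(2) f4(2) by simp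
    have b: "map (slot s1) [20..<24] = map (slot s) [20..<24]" using f1(2) i0(5) by simp
    show "map (slot s4) [20..<24] = best M (\<lambda>u. entry rm cm True (A u)) (Suc t)"
      unfolding a f2(1) b ip z1(4) m0 ent[OF t] best_Suc old ..
    have a: "map (slot s4) [24..<28] = map (slot s3) [24..<28]" using f4(2) by simp
    have b: "map (slot s2) [24..<28] = map (slot s) [24..<28]" using f2(2) f1(2) i0(5) by simp
    show "map (slot s4) [24..<28] = best M (\<lambda>u. entry rm cm False (A (n - Suc u))) (Suc t)"
      unfolding a f3(1) b ip z2(4) m0 ent[OF t'] best_Suc old ..
    have b: "map (slot s3) [28..<32] = map (slot s) [28..<32]" using f3(2) f2(2) f1(2) i0(5) by simp
    show "map (slot s4) [28..<32] = best M (\<lambda>u. entry rm cm True (A (n - Suc u))) (Suc t)"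
      unfolding f4(1) b ip z3(4) m0 ent[OF t'] best_Suc old ..
  qed
  have split: "[16..<32] = [16..<20] @ [20..<24] @ [24..<28] @ [28..<32::nat]"
    by (simp add: upt_rec)
  have rec: "map (slot s4) [16..<32] = record_at n M rm cm A (Suc t)"
    unfolding split map_append slots record_at_def ..
  have d: "ireg s4 22 = 2 * n + 16 * t" using regs(1)[of 22] inv by (simp add: scan_inv_def)
  have len: "length [16..<32::nat] = 16" by simp
  note st = ev_stores[OF z4(2), of "[16..<32]", folded s5_def, unfolded rec d len]
  have slot5: "slot s5 = slot s4" using st by (simp add: slot_def fun_eq_iff)
  have cells: "cells s5 (2 * n + 16 * u) 16 = record_at n M rm cm A (Suc u)" if "u < Suc t" for u
  proof (cases "u = t")
    case True
    then show ?thesis using st by simp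
  next
    case False
    then have "cells s5 (2 * n + 16 * u) 16 = cells s (2 * n + 16 * u) 16"
      using st mem that by (auto simp: cells_def same_mem_def)
    then show ?thesis using inv that False by (simp add: scan_inv_def)
  qed
  \<comment> \<open>The new record is written entirely above the input and the earlier
    records.\<close>
  have low: "rmem s5 i = rmem s i \<and> cmem s5 i = cmem s i" if "i < 2 * n + 16 * t" for i
    using st mem that by (simp add: same_mem_def)
  have slot6: "slot (ev scan_step s) = slot s5" by (simp add: s6 slot_def fun_eq_iff)
  have reg5: "ireg s5 q = ireg s q" if "q \<notin> {5, 7, 8, 9, 21, 22}" for q
    using st regs(1) that by simp
  let ?s = "ev scan_step s"
  have s6': "ireg ?s = (ireg s5)(20 := ireg s5 20 + ireg s5 1)" "rreg ?s = rreg s5" "imem ?s = imem s5"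
    "rmem ?s = rmem s5" "cmem ?s = cmem s5" "cells ?s = cells s5"
    by (simp_all add: s6 cells_def fun_eq_iff)
  have s5': "rreg s5 = rreg s4" "imem s5 = imem s" "ireg s5 22 = 2 * n + 16 * t + 16" "ireg s5 21 = n - Suc t"
    using st mem regs(2) by (simp_all add: same_mem_def)
  have old: "ireg s 0 = n" "ireg s 1 = 1" "ireg s 3 = 0" "ireg s 4 = 0" "ireg s 20 = t"
    "\<forall>u<n. imem s (ireg s 11 + u) = A u" "\<forall>i<2 * n. rmem s i = rm i" "\<forall>i<n. cmem s i = cm i"
    using inv unfolding scan_inv_def by blast+
  have new: "ireg ?s 0 = n" "ireg ?s 1 = 1" "ireg ?s 3 = 0" "ireg ?s 4 = 0" "ireg ?s 20 = Suc t"
    "\<forall>u<n. imem ?s (ireg ?s 11 + u) = A u" "ireg ?s 21 = n - Suc t" "ireg ?s 22 = 2 * n + 16 * Suc t"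
    "rreg ?s 2 = M" "rreg ?s 3 = 0"
    using old z4(3,4) by (simp_all add: s6' s5' reg5)
  have new_mem: "\<forall>i<2 * n. rmem ?s i = rm i" "\<forall>i<n. cmem ?s i = cm i"
    using low old(7,8) unfolding s6' by simp_all
  show ?thesis
    unfolding scan_inv_def slot6 slot5 s6'(6)
    by (intro conjI new new_mem slots) (use t cells in auto)
qed

section \<open>Checking\<close>

text \<open>Color registers are still 0 after sorting, so copying the sentinel into the real
  registers makes each slot the empty entry \<open>(M, 0)\<close>.\<close>

definition scan_init :: com where
  "scan_init = ops [IConst 20 0, IMove 21 0, IAdd 22 0 0] ;; seqs (map (\<lambda>r. Op (RMove r 2)) [16..<32])"

definition scan :: com where
  "scan = scan_init ;; While (ILess 20 0) scan_step"

lemma loop_free_scan_step: "loop_free scan_step"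
  by (simp add: scan_step_def feed_def insert_code_def raise_def swap_max_def store_def)

lemma ensures_scan:
  assumes s: "sorted_state n M rm cm s" and A: "A = (\<lambda>u. imem s (ireg s 11 + u))"
  shows "ensures scan (cost scan_init + (n * (cost scan_step + 2) + 2)) s (scan_inv n M rm cm A n)"
  unfolding scan_def
proof (rule ensures_Seq)
  have "scan_inv n M rm cm A 0 (ev scan_init s)"
    using s A by (simp add: scan_inv_def scan_init_def sorted_state_def base_state_def slot_def best_def
        upt_rec eval_nat_numeral)
  then show "ensures scan_init (cost scan_init) s (scan_inv n M rm cm A 0)"
    by (intro ensures_loop_free) (simp_all add: scan_init_def)
next
  have An: "\<forall>u<n. A u < n" using s unfolding A sorted_state_def by auto
  fix s assume "scan_inv n M rm cm A 0 s"
  then show "ensures (While (ILess 20 0) scan_step) (n * (cost scan_step + 2) + 2) s (scan_inv n M rm cm A n)"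
  proof (intro ensures_While[where I = "\<lambda>k s. k \<le> n \<and> scan_inv n M rm cm A (n - k) s"])
    fix k s assume I: "k \<le> n \<and> scan_inv n M rm cm A (n - k) s" and g: "holds (ILess 20 0) s"
    then have k: "n - k < n" "0 < k" by (auto simp: scan_inv_def)
    from k(2) conjunct1[OF I] have e: "Suc (n - k) = n - (k - 1)" by arith
    from scan_inv_step[OF conjunct2[OF I] k(1) An]
    have "\<exists>k'<k. k' \<le> n \<and> scan_inv n M rm cm A (n - k') (ev scan_step s)"
      unfolding e using conjunct1[OF I] k(2) by (intro exI[of _ "k - 1"]) simp
    then show "ensures scan_step (cost scan_step) s (\<lambda>s'. \<exists>k'<k. k' \<le> n \<and> scan_inv n M rm cm A (n - k') s')"
      by (rule ensures_loop_free[OF loop_free_scan_step])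
  next
    fix k s assume I: "k \<le> n \<and> scan_inv n M rm cm A (n - k) s" and g: "\<not> holds (ILess 20 0) s"
    then have "n - k = n" by (auto simp: scan_inv_def)
    with I show "scan_inv n M rm cm A n s" by simp
  qed simp
qed

section \<open>Testing one split\<close>

definition load :: "nat \<Rightarrow> com" where
  "load r = ops [RLoad r 5, CLoad r 5, IAdd 5 5 1]"

lemma ev_loads:
  fixes s :: ram_state and rs :: "nat list"
  assumes "ireg s 1 = 1" "distinct rs"
  defines "s' \<equiv> ev (seqs (map load rs)) s"
  shows "map (slot s') rs = cells s (ireg s 5) (length rs) \<and>
    (\<forall>q. q \<notin> set rs \<longrightarrow> slot s' q = slot s q) \<and> same_mem s s' \<and>
    ireg s' = (ireg s)(5 := ireg s 5 + length rs)"
  using assms(1,2) unfolding s'_def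
proof (induction rs arbitrary: s)
  case (Cons r rs)
  let ?s = "ev (load r) s"
  have h: "slot ?s r = (rmem s (ireg s 5), cmem s (ireg s 5))" "\<And>q. q \<noteq> r \<Longrightarrow> slot ?s q = slot s q"
    "same_mem s ?s" "ireg ?s = (ireg s)(5 := Suc (ireg s 5))"
    using Cons.prems by (simp_all add: load_def slot_def same_mem_def)
  have c: "cells ?s a k = cells s a k" for a k using h(3) by (simp add: cells_def same_mem_def)
  show ?case
    using Cons.IH[of ?s, unfolded h(4) c] Cons.prems h(1-3) by (auto simp: cells_Suc same_mem_def)
qed (simp add: same_mem_def cells_def)

lemma ev_negates:
  fixes s :: ram_state and rs :: "nat list"
  assumes "rreg s 3 = 0" "distinct rs" "3 \<notin> set rs"
  shows "ev (seqs (map (\<lambda>r. Op (RSub r 3 r)) rs)) s =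
    s\<lparr>rreg := (\<lambda>q. if q \<in> set rs then - rreg s q else rreg s q)\<rparr>"
  using assms
proof (induction rs arbitrary: s)
  case (Cons r rs)
  then show ?case by (auto simp: fun_eq_iff intro!: ram_state.equality)
qed simp

text \<open>The heights of \<open>b\<close> and \<open>d\<close> are expected with their sign
  restored, so the gap is decided by plain comparisons. Register 4 is only ever set, never cleared,
  and so accumulates a disjunction over all tests.\<close>

definition test :: "nat \<times> nat \<times> nat \<times> nat \<Rightarrow> com" where
  "test = (\<lambda>(a, b, c, d).
     foldr (\<lambda>g e. Cond g e Skip) [RLess b a, RLess d a, RLess b c, RLess d c]
      (foldr (\<lambda>g e. Cond g Skip e) [CEq a b, CEq a c, CEq a d, CEq b c, CEq b d, CEq c d]
        (Op (IConst 4 1))))"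

definition register_gap :: "(nat \<Rightarrow> real) \<Rightarrow> (nat \<Rightarrow> nat) \<Rightarrow> nat \<times> nat \<times> nat \<times> nat \<Rightarrow> bool" where
  "register_gap rr cr = (\<lambda>(a, b, c, d). rr b < rr a \<and> rr d < rr a \<and> rr b < rr c \<and> rr d < rr c \<and>
     distinct [cr a, cr b, cr c, cr d])"

lemma ev_test:
  "ev (test q) s = (if register_gap (rreg s) (creg s) q then s\<lparr>ireg := (ireg s)(4 := 1)\<rparr> else s)"
  by (cases q) (auto simp: test_def register_gap_def)

lemma ev_tests:
  "ev (seqs (map test qs)) s =
    (if \<exists>q\<in>set qs. register_gap (rreg s) (creg s) q then s\<lparr>ireg := (ireg s)(4 := 1)\<rparr> else s)"
  by (induction qs arbitrary: s) (auto simp: ev_test)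

definition quadruples :: "(nat \<times> nat \<times> nat \<times> nat) list" where
  "quadruples = List.product [16..<20] (List.product [20..<24] (List.product [24..<28] [28..<32]))"

text \<open>Each of the two records contributes one half: the first 8 entries of the left one are
  champions seen from the left, the last 8 of the other are seen from the right. Register 26 holds
  the offset 8.\<close>

definition check_split :: com where
  "check_split = Op (IMove 5 23) ;; seqs (map load [16..<24]) ;; Op (IAdd 5 24 26) ;;
     seqs (map load [24..<32]) ;; seqs (map (\<lambda>r. Op (RSub r 3 r)) ([20..<24] @ [28..<32])) ;;
     seqs (map test quadruples)"

text \<open>Moving the split by one point lengthens the prefix and shortens the suffix, so the two
  record pointers move in opposite directions by 16 cells.\<close>

definition check_step :: com where
  "check_step = ops [ISub 5 20 1, IAdd 5 5 11, ILoad 8 5, IAdd 5 11 20, ILoad 9 5,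
      IAdd 5 8 8, RLoad 0 5, IAdd 5 9 9, RLoad 1 5] ;;
     Cond (RLess 0 1) check_split Skip ;;
     ops [IAdd 23 23 25, ISub 24 24 25, IAdd 20 20 1]"

lemma length_best [simp]: "length (best M f t) = 4"
proof -
  have "length (fold (insert_champion M) ps ls) = length ls" for ps ls
    by (induction ps arbitrary: ls) auto
  then show ?thesis by (simp add: best_def)
qed

lemma ev_check_split:
  fixes s :: ram_state
  assumes s: "ireg s 1 = 1" "rreg s 3 = 0" "ireg s 26 = 8"
    and l: "cells s (ireg s 23) 16 = record_at n M rm cm A t"
    and r: "cells s (ireg s 24) 16 = record_at n M rm cm A t'"
  defines "s' \<equiv> ev check_split s"
  shows "same_mem s s'" "\<And>q. q \<noteq> 5 \<Longrightarrow> q \<noteq> 4 \<Longrightarrow> ireg s' q = ireg s q" "rreg s' 3 = 0"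
    "ireg s' 4 = (if \<exists>a\<in>set (best M (\<lambda>u. entry rm cm False (A u)) t).
       \<exists>b\<in>set (best M (\<lambda>u. entry rm cm True (A u)) t).
       \<exists>c\<in>set (best M (\<lambda>u. entry rm cm False (A (n - Suc u))) t').
       \<exists>d\<in>set (best M (\<lambda>u. entry rm cm True (A (n - Suc u))) t').
       rainbow_gap a b c d then 1 else ireg s 4)"
proof -
  let ?as = "best M (\<lambda>u. entry rm cm False (A u)) t"
  let ?bs = "best M (\<lambda>u. entry rm cm True (A u)) t"
  let ?cs = "best M (\<lambda>u. entry rm cm False (A (n - Suc u))) t'"
  let ?ds = "best M (\<lambda>u. entry rm cm True (A (n - Suc u))) t'"
  define s1 where "s1 = ev (seqs (map load [16..<24])) (ev (Op (IMove 5 23)) s)"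
  define s2 where "s2 = ev (seqs (map load [24..<32])) (ev (Op (IAdd 5 24 26)) s1)"
  define s3 where "s3 = ev (seqs (map (\<lambda>r. Op (RSub r 3 r)) ([20..<24] @ [28..<32]))) s2"
  have s': "s' = ev (seqs (map test quadruples)) s3"
    unfolding s'_def check_split_def s1_def s2_def s3_def by simp
  have sp: "[0..<16] = [0..<8] @ map (\<lambda>i. 8 + i) [0..<8::nat]"
    "[16..<24] = [16..<20] @ [20..<24::nat]" "[24..<32] = [24..<28] @ [28..<32::nat]"
    by (simp_all add: upt_rec)
  have cells16: "cells s b 16 = cells s b 8 @ cells s (b + 8) 8" for b
    unfolding cells_def sp by (simp add: add.assoc del: upt_conv_Cons)
  have c1: "cells s (ireg s 23) 8 = ?as @ ?bs"
  proof -
    have "cells s (ireg s 23) 8 @ cells s (ireg s 23 + 8) 8 = (?as @ ?bs) @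
        best M (\<lambda>u. entry rm cm False (A (n - Suc u))) t @ best M (\<lambda>u. entry rm cm True (A (n - Suc u))) t"
      using l by (simp only: cells16 record_at_def append_assoc)
    then show ?thesis by (subst (asm) append_eq_append_conv) simp_all
  qed
  have c2: "cells s (ireg s 24 + 8) 8 = ?cs @ ?ds"
  proof -
    have "cells s (ireg s 24) 8 @ cells s (ireg s 24 + 8) 8 = (best M (\<lambda>u. entry rm cm False (A u)) t' @
        best M (\<lambda>u. entry rm cm True (A u)) t') @ (?cs @ ?ds)"
      using r by (simp only: cells16 record_at_def append_assoc)
    then show ?thesis by (subst (asm) append_eq_append_conv) simp_all
  qed
  have len: "length [16..<24::nat] = 8" "length [24..<32::nat] = 8" by simp_all
  define s0 where "s0 = ev (Op (IMove 5 23)) s"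
  have i0: "ireg s0 = (ireg s)(5 := ireg s 23)" "slot s0 = slot s" "same_mem s s0" "ireg s0 1 = 1" "ireg s0 5 = ireg s 23"
    using s by (simp_all add: s0_def slot_def same_mem_def fun_eq_iff)
  have "cells s0 b k = cells s b k" for b k using i0(3) by (simp add: cells_def same_mem_def)
  note l1 = ev_loads[OF i0(4) distinct_upt[of 16 24], folded s1_def[folded s0_def], unfolded len this i0(5) c1]
  have h1: "map (slot s1) [16..<24] = ?as @ ?bs" "\<And>q. q \<notin> {16..<24} \<Longrightarrow> slot s1 q = slot s q"
    "same_mem s s1" "\<And>q. q \<noteq> 5 \<Longrightarrow> ireg s1 q = ireg s q"
    using l1 i0(1-3) unfolding set_upt by (simp_all only: same_mem_def fun_upd_apply simp_thms if_False if_True)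
  define s1' where "s1' = ev (Op (IAdd 5 24 26)) s1"
  have i1: "ireg s1' = (ireg s1)(5 := ireg s 24 + 8)" "slot s1' = slot s1" "same_mem s s1'" "ireg s1' 1 = 1"
    "ireg s1' 5 = ireg s 24 + 8"
    using s h1(3) by (simp_all add: s1'_def slot_def same_mem_def fun_eq_iff h1(4))
  have "cells s1' b k = cells s b k" for b k using i1(3) by (simp add: cells_def same_mem_def)
  note l2 = ev_loads[OF i1(4) distinct_upt[of 24 32], folded s2_def[folded s1'_def], unfolded len this i1(5) c2]
  have h2: "map (slot s2) [24..<32] = ?cs @ ?ds" "\<And>q. q \<notin> {24..<32} \<Longrightarrow> slot s2 q = slot s1 q"
    "same_mem s s2" "\<And>q. q \<noteq> 5 \<Longrightarrow> ireg s2 q = ireg s q"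
    using l2 i1(1-3) h1(4) unfolding set_upt by (simp_all only: same_mem_def fun_upd_apply simp_thms if_False if_True)
  have "map (slot s2) [16..<24] = map (slot s1) [16..<24]"
    using h2(2) by (intro map_cong) auto
  with h1(1) h2(1) have "map (slot s2) [16..<20] @ map (slot s2) [20..<24] = ?as @ ?bs"
    "map (slot s2) [24..<28] @ map (slot s2) [28..<32] = ?cs @ ?ds"
    unfolding sp map_append by simp_all
  then have m: "map (slot s2) [16..<20] = ?as" "map (slot s2) [20..<24] = ?bs"
    "map (slot s2) [24..<28] = ?cs" "map (slot s2) [28..<32] = ?ds"
    by (subst (asm) (1 2) append_eq_append_conv; simp)+
  have z: "rreg s2 3 = 0" using h1(2)[of 3] h2(2)[of 3] s(2) by (simp add: slot_def)
  have s3: "s3 = s2\<lparr>rreg := (\<lambda>q. if q \<in> set ([20..<24] @ [28..<32]) then - rreg s2 q else rreg s2 q)\<rparr>"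
    unfolding s3_def by (rule ev_negates) (use z in auto)
  have g: "register_gap (rreg s3) (creg s3) (a, b, c, d) \<longleftrightarrow>
      rainbow_gap (slot s2 a) (slot s2 b) (slot s2 c) (slot s2 d)"
    if "a \<in> {16..<20}" "b \<in> {20..<24}" "c \<in> {24..<28}" "d \<in> {28..<32}" for a b c d
    using that by (auto simp: s3 register_gap_def rainbow_gap_def slot_def)
  have "(\<exists>q\<in>set quadruples. register_gap (rreg s3) (creg s3) q) \<longleftrightarrow>
    (\<exists>a\<in>{16..<20}. \<exists>b\<in>{20..<24}. \<exists>c\<in>{24..<28}. \<exists>d\<in>{28..<32}.
       rainbow_gap (slot s2 a) (slot s2 b) (slot s2 c) (slot s2 d))"
    using g unfolding quadruples_def set_product set_upt by fast
  also have "\<dots> \<longleftrightarrow> (\<exists>a\<in>set ?as. \<exists>b\<in>set ?bs. \<exists>c\<in>set ?cs. \<exists>d\<in>set ?ds. rainbow_gap a b c d)"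
    unfolding m[symmetric] set_map set_upt by blast
  finally have e: "s' = (if \<exists>a\<in>set ?as. \<exists>b\<in>set ?bs. \<exists>c\<in>set ?cs. \<exists>d\<in>set ?ds. rainbow_gap a b c d
      then s3\<lparr>ireg := (ireg s3)(4 := 1)\<rparr> else s3)"
    unfolding s' ev_tests by simp
  show "same_mem s s'" "\<And>q. q \<noteq> 5 \<Longrightarrow> q \<noteq> 4 \<Longrightarrow> ireg s' q = ireg s q" "rreg s' 3 = 0"
    "ireg s' 4 = (if \<exists>a\<in>set ?as. \<exists>b\<in>set ?bs. \<exists>c\<in>set ?cs. \<exists>d\<in>set ?ds. rainbow_gap a b c d
      then 1 else ireg s 4)"
    using h2(3,4) z unfolding e s3 by (simp_all add: same_mem_def)
qed

section \<open>The loop over all splits\<close>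

definition split_gap where
  "split_gap n M rm cm A t \<longleftrightarrow> x_key rm (A t) < x_key rm (A (Suc t)) \<and>
     (\<exists>a\<in>set (best M (\<lambda>u. entry rm cm False (A u)) (Suc t)).
      \<exists>b\<in>set (best M (\<lambda>u. entry rm cm True (A u)) (Suc t)).
      \<exists>c\<in>set (best M (\<lambda>u. entry rm cm False (A (n - Suc u))) (n - Suc t)).
      \<exists>d\<in>set (best M (\<lambda>u. entry rm cm True (A (n - Suc u))) (n - Suc t)).
      rainbow_gap a b c d)"

text \<open>Split \<open>t\<close> has \<open>t + 1\<close> points on its left, recorded at index
  \<open>t\<close>, and \<open>n - t - 1\<close> on its right, recorded at index
  \<open>n - t - 2\<close>. The latter address is written as one truncated subtraction, in agreement
  with the repeated subtractions of the machine even when they reach 0.\<close>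

definition check_inv where
  "check_inv n M rm cm A t s \<longleftrightarrow>
     ireg s 0 = n \<and> ireg s 1 = 1 \<and> ireg s 3 = 0 \<and> rreg s 3 = 0 \<and>
     (\<forall>u<n. imem s (ireg s 11 + u) = A u) \<and> ireg s 20 = Suc t \<and> ireg s 25 = 16 \<and> ireg s 26 = 8 \<and>
     ireg s 23 = 2 * n + 16 * t \<and> ireg s 24 = 18 * n - (32 + 16 * t) \<and>
     (\<forall>i<2 * n. rmem s i = rm i) \<and>
     (\<forall>u<n. cells s (2 * n + 16 * u) 16 = record_at n M rm cm A (Suc u)) \<and>
     ireg s 4 = (if \<exists>u<t. split_gap n M rm cm A u then 1 else 0)"

lemma check_inv_step:
  assumes inv: "check_inv n M rm cm A t s" and t: "Suc t < n" and A: "\<forall>u<n. A u < n"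
  shows "check_inv n M rm cm A (Suc t) (ev check_step s)"
proof -
  define s0 where "s0 = ev (ops [ISub 5 20 1, IAdd 5 5 11, ILoad 8 5, IAdd 5 11 20, ILoad 9 5,
      IAdd 5 8 8, RLoad 0 5, IAdd 5 9 9, RLoad 1 5]) s"
  define s1 where "s1 = ev (Cond (RLess 0 1) check_split Skip) s0"
  have s2: "ev check_step s = ev (ops [IAdd 23 23 25, ISub 24 24 25, IAdd 20 20 1]) s1"
    unfolding check_step_def s1_def s0_def by simp
  have At: "A t < n" "A (Suc t) < n" using A t by auto
  have im: "imem s (ireg s 11 + t) = A t" "imem s (ireg s 11 + Suc t) = A (Suc t)"
    using inv t by (auto simp: check_inv_def)
  have i0: "\<And>q. q \<notin> {5, 8, 9} \<Longrightarrow> ireg s0 q = ireg s q" "same_mem s s0" "rreg s0 3 = 0"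
    "rreg s0 0 = x_key rm (A t)" "rreg s0 1 = x_key rm (A (Suc t))"
    using inv At im t by (simp_all add: s0_def same_mem_def check_inv_def add.commute)
  have c0: "cells s0 b k = cells s b k" for b k using i0(2) by (simp add: cells_def same_mem_def)
  have l: "cells s0 (ireg s0 23) 16 = record_at n M rm cm A (Suc t)"
    using inv t by (simp add: c0 i0(1) check_inv_def)
  \<comment> \<open>Under \<open>Suc t < n\<close> nothing is truncated, and the pointer is at the
    record for suffixes of length \<open>n - Suc t\<close>.\<close>
  have e: "18 * n - (32 + 16 * t) = 2 * n + 16 * (n - Suc (Suc t))"
    "Suc (n - Suc (Suc t)) = n - Suc t" using t by simp_all
  have r: "cells s0 (ireg s0 24) 16 = record_at n M rm cm A (n - Suc t)"
    using inv t e by (simp add: c0 i0(1) check_inv_def)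
  have z: "ireg s0 1 = 1" "ireg s0 26 = 8" using inv by (simp_all add: i0(1) check_inv_def)
  note cs = ev_check_split[OF z(1) i0(3) z(2) l r]
  have s1: "same_mem s s1" "\<And>q. q \<notin> {4, 5, 8, 9} \<Longrightarrow> ireg s1 q = ireg s q" "rreg s1 3 = 0"
    "ireg s1 4 = (if split_gap n M rm cm A t then 1 else ireg s 4)"
    using cs i0 by (simp_all add: s1_def split_gap_def same_mem_def)
  have c1: "cells s1 b k = cells s b k" for b k using s1(1) by (simp add: cells_def same_mem_def)
  have c2: "cells (ev check_step s) b k = cells s b k" for b k
    using c1[of b k] by (simp add: s2 cells_def)
  have "ireg s1 4 = (if \<exists>u<Suc t. split_gap n M rm cm A u then 1 else 0)"
    using s1(4) inv by (auto simp: check_inv_def less_Suc_eq)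
  then show ?thesis
    using inv s1(1,3) unfolding check_inv_def c2
    by (simp add: s2 s1(2) same_mem_def)
qed

definition check_init :: com where
  "check_init = ops [IConst 20 1, IConst 25 16, IConst 26 8, ISub 24 22 25, ISub 24 24 25, IAdd 23 0 0]"

definition check :: com where
  "check = check_init ;; While (ILess 20 0) check_step"

lemma loop_free_check_step: "loop_free check_step"
  by (auto simp: check_step_def check_split_def load_def test_def)

lemma ensures_check:
  assumes s: "scan_inv n M rm cm A n s" and A: "\<forall>u<n. A u < n"
  shows "ensures check (cost check_init + (n * (cost check_step + 2) + 2)) s
    (\<lambda>s. ireg s 3 = 0 \<and> ireg s 4 = (if \<exists>t. Suc t < n \<and> split_gap n M rm cm A t then 1 else 0))"
  unfolding check_def
proof (rule ensures_Seq)
  have "check_inv n M rm cm A 0 (ev check_init s)"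
    using s by (simp add: check_inv_def check_init_def scan_inv_def cells_def)
  then show "ensures check_init (cost check_init) s (check_inv n M rm cm A 0)"
    by (intro ensures_loop_free) (simp_all add: check_init_def)
next
  \<comment> \<open>Register 20 starts at 1, so only \<open>n - 1\<close> splits are visited. The
    last conjunct keeps the index from passing the last split, so that at the exit
    \<open>u < n - k\<close> means \<open>Suc u < n\<close>; its second disjunct admits
    \<open>n = 0\<close>.\<close>
  define I where "I k s \<longleftrightarrow> check_inv n M rm cm A (n - k) s \<and> k \<le> n \<and>
    (Suc (n - k) \<le> n \<or> n - k = 0)" for k s
  fix s assume "check_inv n M rm cm A 0 s"
  then have "I n s" by (simp add: I_def)
  then show "ensures (While (ILess 20 0) check_step) (n * (cost check_step + 2) + 2) s
    (\<lambda>s. ireg s 3 = 0 \<and> ireg s 4 = (if \<exists>t. Suc t < n \<and> split_gap n M rm cm A t then 1 else 0))"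
  proof (rule ensures_While[where I = I])
    fix k s assume I: "I k s" and g: "holds (ILess 20 0) s"
    then have k: "Suc (n - k) < n" "0 < k" by (auto simp: I_def check_inv_def)
    have e: "Suc (n - k) = n - (k - 1)" using k I unfolding I_def by arith
    have "check_inv n M rm cm A (Suc (n - k)) (ev check_step s)"
      using check_inv_step[OF _ k(1) A] I by (simp only: I_def)
    moreover have "k - 1 \<le> n \<and> (Suc (Suc (n - k)) \<le> n \<or> Suc (n - k) = 0)"
      using k(1) I unfolding I_def by arith
    ultimately have "I (k - 1) (ev check_step s)"
      unfolding I_def e by blast
    then have "\<exists>k'<k. I k' (ev check_step s)" using k by (intro exI[of _ "k - 1"]) simp
    then show "ensures check_step (cost check_step) s (\<lambda>s'. \<exists>k'<k. I k' s')"
      by (rule ensures_loop_free[OF loop_free_check_step])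
  next
    fix k s assume I: "I k s" and g: "\<not> holds (ILess 20 0) s"
    then have le: "n \<le> Suc (n - k)" by (auto simp: I_def check_inv_def)
    have "u < n - k \<longleftrightarrow> Suc u < n" for u
      using I le unfolding I_def by arith
    then have "(\<exists>u<n - k. split_gap n M rm cm A u) \<longleftrightarrow> (\<exists>t. Suc t < n \<and> split_gap n M rm cm A t)"
      by simp
    then show "ireg s 3 = 0 \<and> ireg s 4 = (if \<exists>t. Suc t < n \<and> split_gap n M rm cm A t then 1 else 0)"
      using I by (simp add: I_def check_inv_def)
  qed
qed

section \<open>Correctness and running time\<close>

lemma sentinel_bounds:
  assumes "p < n"
  shows "\<bar>rm (Suc (p + p))\<bar> < - sentinel n rm"
proof -
  let ?y = "rm (Suc (p + p))"
  have "?y * ?y \<le> (\<Sum>u<n. rm (Suc (u + u)) * rm (Suc (u + u)))"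
    using assms by (intro member_le_sum) auto
  \<comment> \<open>For \<open>|y| <= 1\<close> strictness comes from \<open>y * y > 0\<close>, or
    from the summand 1 when \<open>y = 0\<close>; for larger \<open>|y|\<close> the square
    dominates.\<close>
  moreover have "\<bar>?y\<bar> < 1 + ?y * ?y"
  proof (cases "\<bar>?y\<bar> \<le> 1")
    case True
    show ?thesis
    proof (cases "?y = 0")
      case False
      then have "0 < ?y * ?y" by (auto simp: zero_less_mult_iff)
      with True show ?thesis by linarith
    qed simp
  next
    case False
    then have "\<bar>?y\<bar> * 1 \<le> \<bar>?y\<bar> * \<bar>?y\<bar>" by (intro mult_left_mono) auto
    then show ?thesis by simp
  qed
  ultimately show ?thesis unfolding sentinel_def by linarith
qed

section \<open>From recorded champions back to crosses\<close>

lemma champions_best: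
  assumes "\<And>u. u < t \<Longrightarrow> M < fst (f u)"
  shows "champions M (f ` {..<t}) (best M f t)"
proof -
  have "M < fst q" if "q \<in> set (map f [0..<t])" for q
    using that assms by auto
  from champions_fold[where ps = "map f [0..<t]" and M = M and c = 0, OF this] show ?thesis
    by (simp add: best_def lessThan_atLeast0)
qed

text \<open>The right-hand champions are collected backwards, but \<open>champions\<close> refers to
  a set, so only the image of that scan counts.\<close>

lemma reversed_image:
  fixes t n :: nat
  assumes "t \<le> n"
  shows "(\<lambda>u. f (n - Suc u)) ` {..<n - t} = f ` {t..<n}"
proof -
  have "(\<lambda>u. n - Suc u) ` {..<n - t} = {t..<n}"
  proof (intro set_eqI iffI)
    fix v assume "v \<in> {t..<n}"
    then show "v \<in> (\<lambda>u. n - Suc u) ` {..<n - t}"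
      by (intro image_eqI[of _ _ "n - Suc v"]) auto
  qed auto
  then show ?thesis by (metis image_image)
qed

lemma split_gap_iff:
  assumes t: "Suc t < n" and A: "\<forall>u<n. A u < n"
  shows "split_gap n (sentinel n rm) rm cm A t \<longleftrightarrow> x_key rm (A t) < x_key rm (A (Suc t)) \<and>
    (\<exists>a\<in>(\<lambda>u. entry rm cm False (A u)) ` {..t}. \<exists>b\<in>(\<lambda>u. entry rm cm True (A u)) ` {..t}.
     \<exists>c\<in>(\<lambda>u. entry rm cm False (A u)) ` {Suc t..<n}. \<exists>d\<in>(\<lambda>u. entry rm cm True (A u)) ` {Suc t..<n}.
     rainbow_gap a b c d)"
proof -
  let ?M = "sentinel n rm" and ?e = "\<lambda>neg u. entry rm cm neg (A u)"
  have bounds: "?M < fst (?e neg u) \<and> fst (?e neg u) < - ?M" if "u < n" for neg u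
    using sentinel_bounds[of "A u" n rm] A that by (auto simp: entry_def)
  have left: "champions ?M (?e neg ` {..t}) (best ?M (?e neg) (Suc t))" for neg
    unfolding lessThan_Suc_atMost[symmetric] using bounds t by (intro champions_best) auto
  have right: "champions ?M (?e neg ` {Suc t..<n}) (best ?M (\<lambda>u. ?e neg (n - Suc u)) (n - Suc t))" for neg
    unfolding reversed_image[OF less_imp_le[OF t], of "?e neg", symmetric]
    using bounds t by (intro champions_best) auto
  \<comment> \<open>As there is at least one point, \<open>0 <= |y| < - M\<close> holds for its
    ordinate.\<close>
  have "?M < 0" using sentinel_bounds[of 0 n rm] t by linarith
  moreover have "?M < fst q \<and> fst q < - ?M"
    if "q \<in> ?e False ` {..t} \<union> ?e True ` {..t} \<union> ?e False ` {Suc t..<n} \<union> ?e True ` {Suc t..<n}" for q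
    using that t bounds by (elim UnE imageE) simp_all
  ultimately show ?thesis
    unfolding split_gap_def
    by (intro conj_cong refl) (rule rainbow_gap_champions[OF left left right right, symmetric])
qed

lemma exists_split_gap_iff:
  assumes A: "A ` {..<n} = {..<n}"
    and sorted: "\<And>u v. u \<le> v \<Longrightarrow> v < n \<Longrightarrow> x_key rm (A u) \<le> x_key rm (A v)"
    and P: "(\<lambda>p. (x_key rm p, rm (Suc (p + p)))) ` {..<n} = P"
    and col: "\<And>p. p < n \<Longrightarrow> cm p = col (x_key rm p, rm (Suc (p + p)))"
  shows "(\<exists>t. Suc t < n \<and> split_gap n (sentinel n rm) rm cm A t) \<longleftrightarrow> contains_four_colored_cross P col"
proof -
  define pt where "pt u = (x_key rm (A u), rm (Suc (A u + A u)))" for u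
  have An: "\<forall>u<n. A u < n" using A by blast
  have "pt ` {..<n} = (\<lambda>p. (x_key rm p, rm (Suc (p + p)))) ` A ` {..<n}"
    unfolding pt_def image_image ..
  then have "pt ` {..<n} = P" unfolding A P .
  moreover have "fst (pt u) \<le> fst (pt v)" if "u \<le> v" "v < n" for u v
    using sorted that by (simp add: pt_def)
  ultimately have *: "contains_four_colored_cross P col \<longleftrightarrow>
    (\<exists>t. Suc t < n \<and> fst (pt t) < fst (pt (Suc t)) \<and>
      (\<exists>a\<in>(\<lambda>p. (snd p, col p)) ` pt ` {..t}. \<exists>b\<in>(\<lambda>p. (- snd p, col p)) ` pt ` {..t}.
       \<exists>c\<in>(\<lambda>p. (snd p, col p)) ` pt ` {Suc t..<n}. \<exists>d\<in>(\<lambda>p. (- snd p, col p)) ` pt ` {Suc t..<n}.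
         rainbow_gap a b c d))"
    by (rule cross_iff_split)
  have e: "(\<lambda>p. (snd p, col p)) ` pt ` I = (\<lambda>u. entry rm cm False (A u)) ` I"
    "(\<lambda>p. (- snd p, col p)) ` pt ` I = (\<lambda>u. entry rm cm True (A u)) ` I" if "I \<subseteq> {..<n}" for I
    using that An by (auto simp: image_image pt_def entry_def col intro!: image_cong)
  have split: "split_gap n (sentinel n rm) rm cm A t \<longleftrightarrow> fst (pt t) < fst (pt (Suc t)) \<and>
      (\<exists>a\<in>(\<lambda>p. (snd p, col p)) ` pt ` {..t}. \<exists>b\<in>(\<lambda>p. (- snd p, col p)) ` pt ` {..t}.
       \<exists>c\<in>(\<lambda>p. (snd p, col p)) ` pt ` {Suc t..<n}. \<exists>d\<in>(\<lambda>p. (- snd p, col p)) ` pt ` {Suc t..<n}.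
         rainbow_gap a b c d)" if "Suc t < n" for t
  proof -
    have I: "{..t} \<subseteq> {..<n}" "{Suc t..<n} \<subseteq> {..<n}" using that by auto
    show ?thesis
      unfolding split_gap_iff[OF that An] e[OF I(1)] e[OF I(2)] by (simp add: pt_def)
  qed
  show ?thesis
    unfolding * by (rule iff_exI, rule conj_cong[OF refl], erule split)
qed

section \<open>The complete program and its running time\<close>

definition cross_search :: com where
  "cross_search = init ;; sort_by_x ;; scan ;; check"

definition cross_program :: "instr list" where
  "cross_program = compile 0 cross_search @
     [JumpIEq 4 3 (code_length cross_search + 2), Halt True, Halt False]"

definition sort_rounds :: "nat \<Rightarrow> nat" where
  "sort_rounds n = nat \<lceil>log 2 (real n)\<rceil>"

lemma le_two_power_sort_rounds: "n \<le> 2 ^ sort_rounds n"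
proof (cases "n = 0")
  case False
  have "log 2 (real n) \<le> real (sort_rounds n)"
    unfolding sort_rounds_def using of_nat_ceiling by blast
  then have "real n \<le> 2 powr real (sort_rounds n)"
    using False by (simp add: log_le_iff)
  then have "real n \<le> real (2 ^ sort_rounds n)" by (simp add: powr_realpow)
  then show ?thesis by linarith
qed simp

definition cross_time :: "nat \<Rightarrow> nat" where
  "cross_time n = (2 + (n * (cost init_step + 2) + 2)) +
     ((cost sort_init + (sort_rounds n * (pass_time n + 2) + 2)) +
      ((cost scan_init + (n * (cost scan_step + 2) + 2)) +
       (cost check_init + (n * (cost check_step + 2) + 2))))"

lemma ensures_cross_search:
  assumes "k_colored_point_set k P col" "distinct ps" "set ps = P"
  shows "ensures cross_search (cross_time (card P)) (input_state ps col)
    (\<lambda>s. ireg s 3 = 0 \<and> ireg s 4 = (if contains_four_colored_cross P col then 1 else 0))"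
proof -
  let ?s = "input_state ps col"
  define n rm cm where "n = length ps" and "rm = rmem ?s" and "cm = cmem ?s"
  have n: "card P = n" using assms(2,3) by (auto simp: n_def distinct_card)
  have pt: "(x_key rm p, rm (Suc (p + p))) = ps ! p" if "p < n" for p
    using that by (simp add: rm_def n_def input_state_def)
  have P: "(\<lambda>p. (x_key rm p, rm (Suc (p + p)))) ` {..<n} = P"
    using assms(3) pt unfolding set_conv_nth n_def by force
  have col: "cm p = col (x_key rm p, rm (Suc (p + p)))" if "p < n" for p
    using pt[OF that] that by (simp add: cm_def n_def input_state_def)
  show ?thesis
    unfolding cross_search_def cross_time_def n
  proof (rule ensures_Seq[OF ensures_init ensures_Seq[OF ensures_sort_by_x]])
    fix s assume s: "sorted_state n (sentinel n rm) rm cm s"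
    define A where "A = (\<lambda>u. imem s (ireg s 11 + u))"
    have A: "A ` {..<n} = {..<n}" and key: "\<And>u v. u \<le> v \<Longrightarrow> v < n \<Longrightarrow> x_key rm (A u) \<le> x_key rm (A v)"
      using s by (auto simp: sorted_state_def A_def)
    have An: "\<forall>u<n. A u < n" using A by blast
    have eq: "(\<exists>t. Suc t < n \<and> split_gap n (sentinel n rm) rm cm A t) \<longleftrightarrow> contains_four_colored_cross P col"
      by (rule exists_split_gap_iff) (use A key P col in simp_all)
    have "ensures check (cost check_init + (n * (cost check_step + 2) + 2)) s
        (\<lambda>s. ireg s 3 = 0 \<and> ireg s 4 = (if contains_four_colored_cross P col then 1 else 0))"
      if "scan_inv n (sentinel n rm) rm cm A n s" for s
      using ensures_check[OF that An] unfolding eq .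
    then show "ensures (scan ;; check) ((cost scan_init + (n * (cost scan_step + 2) + 2)) +
       (cost check_init + (n * (cost check_step + 2) + 2))) s
      (\<lambda>s. ireg s 3 = 0 \<and> ireg s 4 = (if contains_four_colored_cross P col then 1 else 0))"
      by (rule ensures_Seq[OF ensures_scan[OF s A_def]])
  qed (auto simp: n_def rm_def cm_def input_state_def le_two_power_sort_rounds)
qed

lemma cross_program_decides: "decides_four_colored_cross_in_time cross_program (\<lambda>n. cross_time n + 1)"
  unfolding decides_four_colored_cross_in_time_def
proof (intro allI impI)
  fix k P col ps
  assume "k_colored_point_set k P col" "distinct ps" "set ps = P"
  from ensures_cross_search[OF this] obtain s' where
    s': "ireg s' 3 = 0" "ireg s' 4 = (if contains_four_colored_cross P col then 1 else 0)"
    and r: "\<And>xs ys. reach (xs @ compile (length xs) cross_search @ ys) (cross_time (card P))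
       ((input_state ps col)\<lparr>pc := length xs\<rparr>) (s'\<lparr>pc := length xs + code_length cross_search\<rparr>)"
    by (auto simp: ensures_def)
  let ?l = "code_length cross_search" and ?b = "contains_four_colored_cross P col"
  have pc0: "(input_state ps col)\<lparr>pc := 0\<rparr> = input_state ps col" by (simp add: input_state_def)
  have "reach cross_program (cross_time (card P)) (input_state ps col) (s'\<lparr>pc := ?l\<rparr>)"
    using r[of "[]"] by (simp add: cross_program_def pc0)
  \<comment> \<open>The concluding jump is the one step beyond \<open>cross_time\<close>; standing
    at a \<open>Halt\<close> already counts as having answered.\<close>
  moreover have "reach cross_program 1 (s'\<lparr>pc := ?l\<rparr>) (s'\<lparr>pc := if ?b then ?l + 1 else ?l + 2\<rparr>)"
    by (rule reach_step)
      (use s' in \<open>auto simp: cross_program_def step_def nth_append jump_if_def next_pc_def\<close>)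
  ultimately have "reach cross_program (cross_time (card P) + 1) (input_state ps col)
      (s'\<lparr>pc := if ?b then ?l + 1 else ?l + 2\<rparr>)"
    by (rule reach_trans)
  moreover have "halted cross_program (s'\<lparr>pc := if ?b then ?l + 1 else ?l + 2\<rparr>) ?b"
    by (auto simp: halted_def cross_program_def nth_append)
  ultimately show "answers_within cross_program (input_state ps col) ?b (cross_time (card P) + 1)"
    unfolding answers_within_def reach_def by metis
qed

text \<open>For positive \<open>n\<close> every additive constant is absorbed by a multiple of
  \<open>n\<close>. The \<open>+ 1\<close> beside the rounds accounts for the linear work, since a
  single point takes no sorting round.\<close>

lemma cross_time_bound: "\<exists>K. \<forall>n>0. cross_time n + 1 \<le> K * (n * (sort_rounds n + 1))"
proof -
  \<comment> \<open>The summand 20 makes \<open>c\<close> exceed the bare constants 2 and 11 that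
    occur below, including the 2 added to the cost of each loop body.\<close>
  define c where "c = cost init_step + cost sort_init + cost scan_init + cost scan_step +
    cost check_init + cost check_step + cost start_pass + cost merge_step + cost finish_pass + 20"
  have "cross_time n + 1 \<le> 20 * c * (n * (sort_rounds n + 1))" if "0 < n" for n
  proof -
    have c: "a \<le> c * n" if "a \<le> c" for a
      using that \<open>0 < n\<close> by (cases n) (auto simp: trans_le_add1)
    have m: "n * a \<le> c * n" if "a \<le> c" for a
      using mult_le_mono1[OF that, of n] by (simp add: mult.commute)
    \<comment> \<open>Five summands, each at most \<open>c * n\<close>: start, loop rounds, finish,
      and 2 twice.\<close>
    have "pass_time n + 2 \<le> 5 * (c * n)"
      unfolding pass_time_def
      using c[of "cost start_pass"] c[of "cost finish_pass"] c[of 2] m[of "cost merge_step + 2"]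
      by (simp add: c_def)
    then have "sort_rounds n * (pass_time n + 2) \<le> 5 * (c * n * sort_rounds n)"
      using mult_le_mono2[of _ _ "sort_rounds n"] by (metis mult.assoc mult.commute)
    \<comment> \<open>Outside the sorting passes there are three initializations, three loops and
      the constants, which add up to 11.\<close>
    moreover have "cross_time n + 1 \<le> sort_rounds n * (pass_time n + 2) + 20 * (c * n)"
      unfolding cross_time_def
      using c[of "cost sort_init"] c[of "cost scan_init"] c[of "cost check_init"] c[of 11]
        m[of "cost init_step + 2"] m[of "cost scan_step + 2"] m[of "cost check_step + 2"]
      by (simp add: c_def)
    ultimately show ?thesis by (simp add: algebra_simps)
  qed
  then show ?thesis by blast
qed

theorem theorem6:
  shows "\<exists>(prog :: instr list) (T :: nat \<Rightarrow> nat).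
    decides_four_colored_cross_in_time prog T \<and>
    (\<lambda>n. real (T n)) \<in> O(\<lambda>n. real n * ln (real n))"
proof (intro exI conjI)
  show "decides_four_colored_cross_in_time cross_program (\<lambda>n. cross_time n + 1)"
    by (rule cross_program_decides)
  obtain K where K: "\<And>n. 0 < n \<Longrightarrow> cross_time n + 1 \<le> K * (n * (sort_rounds n + 1))"
    using cross_time_bound by blast
  show "(\<lambda>n. real (cross_time n + 1)) \<in> O(\<lambda>n. real n * ln (real n))"
  \<comment> \<open>Starting at 2 avoids \<open>ln 1 = 0\<close>. The factor \<open>1 / ln 2\<close>
    changes the base of the logarithm, and 3 is explained by the next estimate.\<close>
  proof (rule bigoI[where c = "real K * (3 / ln 2)"], rule eventually_mono[OF eventually_ge_at_top[of 2]])
    fix n :: nat assume n: "2 \<le> n"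
    have "real (sort_rounds n) \<le> log 2 (real n) + 1"
      using n unfolding sort_rounds_def by (simp add: of_nat_nat)
    moreover have "log 2 2 \<le> log 2 (real n)" using n by (intro log_mono) auto
    \<comment> \<open>Rounding up and the extra 1 together cost at most 2, which is at most
      \<open>2 * log 2 (real n)\<close> for \<open>n >= 2\<close>.\<close>
    ultimately have "real (sort_rounds n) + 1 \<le> 3 * log 2 (real n)" by simp
    then have "real n * (real (sort_rounds n) + 1) \<le> real n * (3 * log 2 (real n))"
      by (intro mult_left_mono) auto
    then have le: "real K * (real n * (real (sort_rounds n) + 1)) \<le> real K * (real n * (3 * log 2 (real n)))"
      by (rule mult_left_mono) simp
    have "real (cross_time n + 1) \<le> real (K * (n * (sort_rounds n + 1)))"
      using K[of n] n by (simp only: of_nat_le_iff)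
    also have "\<dots> = real K * (real n * (real (sort_rounds n) + 1))"
      by (simp only: of_nat_mult of_nat_add of_nat_1)
    also note le
    also have "real K * (real n * (3 * log 2 (real n))) = real K * (3 / ln 2) * (real n * ln (real n))"
      by (simp add: log_def)
    finally have "real (cross_time n + 1) \<le> real K * (3 / ln 2) * (real n * ln (real n))" .
    moreover have "0 \<le> real n * ln (real n)" using n by simp
    ultimately show "norm (real (cross_time n + 1)) \<le> real K * (3 / ln 2) * norm (real n * ln (real n))"
      by simp
  qed
qed

end
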